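(* There exists a constant $\widehat C>0$, independent of $\ell$, $m$, $\delta$, and of the parameter pair $\mu_0,\mu_1\in\mathcal P$, such that for all $\mu_0,\mu_1\in\mathcal P$ (with $\delta=|\mu_1-\mu_0|$), all $m$ satisfying the time step condition (S), and all $\ell\in\{1,\dots,n\}$, $$\left(\frac1m\sum_{k=1}^m\|u_1(t_k)-U_k^1\|_H^2\right)^{1/2}\le\left(\frac1m\sum_{k=1}^m\|u_0(t_k)-U_k^0\|_H^2\right)^{1/2}+\widehat C\,\rho_{\mathcal P}(\delta),$$ where $u_i$ is the exact solution at parameter $\mu_i$ and $\{U_k^i\}_{k=0}^m$ is the Backward Euler--Galerkin solution at parameter $\mu_i$ in the POD space $V^\ell$ constructed at $\mu_0$.
   Context: **Spaces.** $V,H$ are real separable Hilbert spaces, $V$ densely and compactly embedded in $H$; identifying $H\cong H^*$ gives a Gelfand triple $V\hookrightarrow H\cong H^*\hookrightarrow V^*$. $\alpha>0$ is a constant with $\|\varphi\|_H^2\le\alpha\|\varphi\|_V^2$ for all $\varphi\in V$. $T>0$ is fixed and $W(0,T;V)=\{u\in L^2(0,T;V):\partial_t u\in L^2(0,T;V^* )\}$. **Problem.** $\mathcal P\subset(0,\infty)$ is a fixed compact set, $f\in C([0,T];H)$, $\phi\in V$, $a:V\times V\times\mathbb R_{>0}\to\mathbb R$ is bilinear in its first two arguments, and $F:V\times\mathbb R_{>0}\to H$. For $\mu\in\mathcal P$, $u_\mu\in W(0,T;V)$ solves $$\langle\partial_t u_\mu(t),\psi\rangle_{V^*,V}+a(u_\mu(t),\psi;\mu)+\langle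 F(u_\mu(t);\mu),\psi\rangle_H=\langle f(t),\psi\rangle_H\quad\forall\psi\in V,\ \text{a.e. }t\in(0,T),\qquad u_\mu(0)=\phi.$$ **Standing assumptions.** A modulus of continuity is a nondecreasing $\omega:[0,\infty)\to[0,\infty)$ with $\omega(0)=0$ and $\lim_{r\to0}\omega(r)=0$. There are continuous functions $\beta,\kappa:\mathcal P\to(0,\infty)$, $L_F:\mathcal P\to[0,\infty)$ and moduli of continuity $\omega_a^{\mathcal P},\omega_F^{\mathcal P}$ such that for all $\mu,\nu\in\mathcal P$, $\varphi,\psi,u,v\in V$: - (A1) $|a(\varphi,\psi;\mu)|\le\beta(\mu)\|\varphi\|_V\|\psi\|_V$; - (A2) $a(\varphi,\varphi;\mu)\ge\kappa(\mu)\|\varphi\|_V^2$; - (A3) $|a(\varphi,\psi;\mu)-a(\varphi,\psi;\nu)|\le\omega_a^{\mathcal P}(|\mu-\nu|)\|\varphi\|_V\|\psi\|_V$; - (F1) $\|F(u;\mu)-F(v;\mu)\|_H\le L_F(\mu)\|u-v\|_V$; - (F2) $\|F(u;\mu)-F(u;\nu)\|_H\le\omega_F^{\mathcal P}(|\mu-\nu|)(\|u\|_V+1)$. For every $\mu\in\mathcal P$ the problem has a unique solution $u_\mu\in W(0,T;V)\cap C([0,T];H)$, and moreover $u_\mu\in W^{2,2}(0,T;H)\cap C([0,T];V)$ (so $\partial_tu_\mu\in C([0,T];H)$ and the duality pairing is identified with the $H$-inner product). **Notation.** $\underline\kappa_{\mathcal P}=\inf_{\mathcal P}\kappa>0$,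 $\overline L_{F,\mathcal P}=\sup_{\mathcal P}L_F<\infty$, $\rho_{\mathcal P}(s)=\omega_a^{\mathcal P}(s)+\omega_F^{\mathcal P}(s)$ for $s\ge0$. For $\mu_0,\mu_1\in\mathcal P$: $\delta=|\mu_1-\mu_0|$, $u_i=u_{\mu_i}$. For a positive integer $m$: $\Delta t=T/m$, $t_k=k\Delta t$, and $\overline\partial w_k=(w_k-w_{k-1})/\Delta t$ (with $w_k=w(t_k)$ for a function $w$ of time). **Time step condition (S).** $1-\frac{\overline L_{F,\mathcal P}^2}{\underline\kappa_{\mathcal P}}\Delta t\ge\frac12$ and $1-\left(1+L_F(\mu_0)+\frac{L_F(\mu_0)^2}{2\kappa(\mu_0)}\right)\Delta t\ge\frac12$. **POD space.** The snapshots are $y_j=u_0(t_j)$ for $j=0,\dots,m$ and $y_j=\overline\partial u_0(t_{j-m})=(u_0(t_{j-m})-u_0(t_{j-m-1}))/\Delta t$ for $j=m+1,\dots,2m$. Let $n$ be the dimension of their span, and let $\lambda_1\ge\dots\ge\lambda_n>0$ be the positive eigenvalues of the $(2m+1)\times(2m+1)$ matrix $K_{ij}=\frac1{2m+1}\langle y_i,y_j\rangle_V$, with corresponding orthonormal eigenvectors $v_1,\dots,v_n$. The POD basis is $\psi_k=\frac1{\sqrt{(2m+1)\lambda_k}}\sum_{j=0}^{2m}(v_k)_jy_j$, $1\le k\le\ell$, $\ell\in\{1,\dots,n\}$; it is $V$-orthonormal and minimizes $\frac1{2m+1}\sum_{j=0}^{2m}\|y_j-\sum_{k=1}^\ell\langle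 y_j,\psi_k\rangle_V\psi_k\|_V^2$ over $V$-orthonormal families, with minimum value $\sum_{j=\ell+1}^n\lambda_j$. Set $V^\ell=\mathrm{span}\{\psi_1,\dots,\psi_\ell\}$. **Reduced-order scheme.** For $i=0,1$, $\{U_k^i\}_{k=0}^m\subset V^\ell$ (the same $V^\ell$, built at $\mu_0$, for both $i$) satisfies, for all $\psi\in V^\ell$, $\langle U_0^i,\psi\rangle_H=\langle\phi,\psi\rangle_H$ and, for $k=1,\dots,m$, $$\langle\overline\partial U_k^i,\psi\rangle_H+a(U_k^i,\psi;\mu_i)+\langle F(U_k^i;\mu_i),\psi\rangle_H=\langle f(t_k),\psi\rangle_H.$$ *)

theory Defs
  imports "HOL-Analysis.Analysis" "Jordan_Normal_Form.Char_Poly"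
begin

text \<open>
  The spaces are types: \<open>'v\<close> is V and \<open>'h\<close> is H, both of sort
  \<open>{real_inner, banach, second_countable_topology}\<close>, i.e. real separable Hilbert spaces
  (a metric space is separable iff it is second countable). The inclusion of V into H is an
  explicit map \<open>\<iota>\<close>. The dual \<open>V*\<close> is the library type \<open>'v \<Rightarrow>\<^sub>L real\<close> with the operator norm;
  \<open>h\<close> in H is identified with the functional mapping \<open>\<psi>\<close> to \<open>inner h (\<iota> \<psi>)\<close>.

  Inner products are written \<open>inner\<close> and \<open>scalar_prod\<close> because the infix of HOL-Analysis and
  that of Jordan_Normal_Form coincide.
\<close>

definition gelfand_embedding :: "('v::real_inner \<Rightarrow> 'h::real_inner) \<Rightarrow> bool" where
  "gelfand_embedding \<iota> \<longleftrightarrow>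
     bounded_linear \<iota> \<and> inj \<iota> \<and> closure (range \<iota>) = UNIV \<and>
     (\<forall>S. bounded S \<longrightarrow> compact (closure (\<iota> ` S)))"

definition modulus_of_continuity :: "(real \<Rightarrow> real) \<Rightarrow> bool" where
  "modulus_of_continuity \<omega> \<longleftrightarrow>
     mono_on {0..} \<omega> \<and> (\<forall>r\<ge>0. \<omega> r \<ge> 0) \<and> \<omega> 0 = 0 \<and> (\<omega> \<longlongrightarrow> 0) (at_right 0)"

text \<open>
  Membership in \<open>L\<^sup>2(0,T;X)\<close>. Since X is H, V or \<open>V*\<close>, all of which are separable,
  Borel measurability is the same as strong measurability.
\<close>

definition L2_on :: "real \<Rightarrow> (real \<Rightarrow> 'b::real_normed_vector) \<Rightarrow> bool" where
  "L2_on T u \<longleftrightarrow>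
     set_borel_measurable lborel {0<..<T} u \<and>
     set_integrable lborel {0<..<T} (\<lambda>t. (norm (u t))\<^sup>2)"

definition test_function :: "real \<Rightarrow> (real \<Rightarrow> real) \<Rightarrow> bool" where
  "test_function T \<eta> \<longleftrightarrow>
     (\<forall>n t. ((deriv ^^ n) \<eta>) differentiable (at t)) \<and> closure {t. \<eta> t \<noteq> 0} \<subseteq> {0<..<T}"

definition weak_derivative ::
    "real \<Rightarrow> (real \<Rightarrow> 'b::{banach, second_countable_topology}) \<Rightarrow> (real \<Rightarrow> 'b) \<Rightarrow> bool" where
  "weak_derivative T w g \<longleftrightarrow>
     (\<forall>\<eta>. test_function T \<eta> \<longrightarrow>
        set_lebesgue_integral lborel {0<..<T} (\<lambda>t. deriv \<eta> t *\<^sub>R w t) =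
        - set_lebesgue_integral lborel {0<..<T} (\<lambda>t. \<eta> t *\<^sub>R g t))"

text \<open>
  The same identity in \<open>V*\<close>, for a V-valued \<open>v\<close> and a \<open>V*\<close>-valued \<open>g\<close>. It is evaluated at each
  \<open>\<psi>\<close> in V, since the library's Bochner integral is not available for the type
  \<open>'v \<Rightarrow>\<^sub>L real\<close> (which has no second-countability instance).
\<close>

definition dual_weak_derivative ::
    "('v::real_inner \<Rightarrow> 'h::real_inner) \<Rightarrow> real \<Rightarrow> (real \<Rightarrow> 'v) \<Rightarrow> (real \<Rightarrow> 'v \<Rightarrow>\<^sub>L real) \<Rightarrow> bool" where
  "dual_weak_derivative \<iota> T v g \<longleftrightarrow>
     (\<forall>\<eta> \<psi>. test_function T \<eta> \<longrightarrow>
        set_lebesgue_integral lborel {0<..<T} (\<lambda>t. deriv \<eta> t * inner (\<iota> (v t)) (\<iota> \<psi>)) =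
        - set_lebesgue_integral lborel {0<..<T} (\<lambda>t. \<eta> t * blinfun_apply (g t) \<psi>))"

text \<open>\<open>v\<close> lies in \<open>W(0,T;V)\<close> and \<open>g\<close> is its time derivative.\<close>

definition W_derivative ::
    "('v::real_inner \<Rightarrow> 'h::real_inner) \<Rightarrow> real \<Rightarrow> (real \<Rightarrow> 'v) \<Rightarrow> (real \<Rightarrow> 'v \<Rightarrow>\<^sub>L real) \<Rightarrow> bool" where
  "W_derivative \<iota> T v g \<longleftrightarrow> L2_on T v \<and> L2_on T g \<and> dual_weak_derivative \<iota> T v g"

definition W22 :: "real \<Rightarrow> (real \<Rightarrow> 'h::{banach, second_countable_topology}) \<Rightarrow> bool" where
  "W22 T w \<longleftrightarrow>
     (\<exists>g h. L2_on T w \<and> L2_on T g \<and> L2_on T h \<and> weak_derivative T w g \<and> weak_derivative T g h)"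

text \<open>
  \<open>solves \<iota> T A G f \<phi> w\<close>: the class \<open>w\<close>, given by its H-valued representative in \<open>C([0,T];H)\<close>, lies
  in \<open>W(0,T;V)\<close> and solves the problem with bilinear form \<open>A\<close> and nonlinearity \<open>G\<close>. An element
  of \<open>W(0,T;V)\<close> takes values in V only almost everywhere; \<open>v\<close> is a V-valued representative.
\<close>

definition solves ::
    "('v::real_inner \<Rightarrow> 'h::real_inner) \<Rightarrow> real \<Rightarrow> ('v \<Rightarrow> 'v \<Rightarrow> real) \<Rightarrow> ('v \<Rightarrow> 'h) \<Rightarrow>
     (real \<Rightarrow> 'h) \<Rightarrow> 'v \<Rightarrow> (real \<Rightarrow> 'h) \<Rightarrow> bool" where
  "solves \<iota> T A G f \<phi> w \<longleftrightarrow>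
     continuous_on {0..T} w \<and> w 0 = \<iota> \<phi> \<and>
     (\<exists>v g. W_derivative \<iota> T v g \<and>
        (AE t in lborel. t \<in> {0<..<T} \<longrightarrow> w t = \<iota> (v t)) \<and>
        (\<forall>\<psi>. AE t in lborel. t \<in> {0<..<T} \<longrightarrow>
           blinfun_apply (g t) \<psi> + A (v t) \<psi> + inner (G (v t)) (\<iota> \<psi>) = inner (f t) (\<iota> \<psi>)))"

definition tgrid :: "real \<Rightarrow> nat \<Rightarrow> nat \<Rightarrow> real" where
  "tgrid T m k = real k * (T / real m)"

definition backward_diff :: "real \<Rightarrow> nat \<Rightarrow> (nat \<Rightarrow> 'b::real_vector) \<Rightarrow> nat \<Rightarrow> 'b" where
  "backward_diff T m w k = (w k - w (k - 1)) /\<^sub>R (T / real m)"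

definition snapshot :: "real \<Rightarrow> nat \<Rightarrow> (real \<Rightarrow> 'v::real_vector) \<Rightarrow> nat \<Rightarrow> 'v" where
  "snapshot T m u j =
     (if j \<le> m then u (tgrid T m j) else backward_diff T m (\<lambda>k. u (tgrid T m k)) (j - m))"

definition snapshot_dim :: "nat \<Rightarrow> (nat \<Rightarrow> 'v::real_vector) \<Rightarrow> nat" where
  "snapshot_dim m y = dim (span (y ` {0..2*m}))"

definition correlation_matrix :: "nat \<Rightarrow> (nat \<Rightarrow> 'v::real_inner) \<Rightarrow> real mat" where
  "correlation_matrix m y =
     mat (2*m+1) (2*m+1) (\<lambda>(i,j). inner (y i) (y j) / real (2*m+1))"

text \<open>
  \<open>lam 1 \<ge> \<dots> \<ge> lam n\<close> lists the positive eigenvalues with multiplicity: the matrix is symmetric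
  positive semidefinite of rank \<open>n = snapshot_dim m y\<close>, so \<open>n\<close> orthonormal eigenvectors for
  positive eigenvalues use up all multiplicities.
\<close>

definition pod_eigenpairs ::
    "nat \<Rightarrow> (nat \<Rightarrow> 'v::real_inner) \<Rightarrow> (nat \<Rightarrow> real) \<Rightarrow> (nat \<Rightarrow> real vec) \<Rightarrow> bool" where
  "pod_eigenpairs m y lam v \<longleftrightarrow>
     (let n = snapshot_dim m y; K = correlation_matrix m y in
       lam ` {1..n} = {x. x > 0 \<and> eigenvalue K x} \<and>
       antimono_on {1..n} lam \<and>
       (\<forall>k\<in>{1..n}. eigenvector K (v k) (lam k)) \<and>
       (\<forall>j\<in>{1..n}. \<forall>k\<in>{1..n}. scalar_prod (v j) (v k) = (if j = k then 1 else 0)))"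

definition pod_basis ::
    "nat \<Rightarrow> (nat \<Rightarrow> 'v::real_vector) \<Rightarrow> (nat \<Rightarrow> real) \<Rightarrow> (nat \<Rightarrow> real vec) \<Rightarrow> nat \<Rightarrow> 'v" where
  "pod_basis m y lam v k =
     (1 / sqrt (real (2*m+1) * lam k)) *\<^sub>R (\<Sum>j=0..2*m. vec_index (v k) j *\<^sub>R y j)"

definition pod_space ::
    "nat \<Rightarrow> (nat \<Rightarrow> 'v::real_vector) \<Rightarrow> (nat \<Rightarrow> real) \<Rightarrow> (nat \<Rightarrow> real vec) \<Rightarrow> nat \<Rightarrow> 'v set" where
  "pod_space m y lam v l = span (pod_basis m y lam v ` {1..l})"

definition reduced_solution ::
    "('v::real_inner \<Rightarrow> 'h::real_inner) \<Rightarrow> real \<Rightarrow> nat \<Rightarrow> ('v \<Rightarrow> 'v \<Rightarrow> real) \<Rightarrow> ('v \<Rightarrow> 'h) \<Rightarrow>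
     (real \<Rightarrow> 'h) \<Rightarrow> 'v \<Rightarrow> 'v set \<Rightarrow> (nat \<Rightarrow> 'v) \<Rightarrow> bool" where
  "reduced_solution \<iota> T m A G f \<phi> Vl U \<longleftrightarrow>
     (\<forall>k\<in>{0..m}. U k \<in> Vl) \<and>
     (\<forall>\<psi>\<in>Vl. inner (\<iota> (U 0)) (\<iota> \<psi>) = inner (\<iota> \<phi>) (\<iota> \<psi>)) \<and>
     (\<forall>k\<in>{1..m}. \<forall>\<psi>\<in>Vl.
        inner (\<iota> (backward_diff T m U k)) (\<iota> \<psi>) + A (U k) \<psi> + inner (G (U k)) (\<iota> \<psi>)
          = inner (f (tgrid T m k)) (\<iota> \<psi>))"

definition time_step_condition ::
    "real set \<Rightarrow> (real \<Rightarrow> real) \<Rightarrow> (real \<Rightarrow> real) \<Rightarrow> real \<Rightarrow> real \<Rightarrow> bool" where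
  "time_step_condition P \<kappa> L \<mu>0 dt \<longleftrightarrow>
     1 - (SUP \<mu>\<in>P. L \<mu>)\<^sup>2 / (INF \<mu>\<in>P. \<kappa> \<mu>) * dt \<ge> 1/2 \<and>
     1 - (1 + L \<mu>0 + (L \<mu>0)\<^sup>2 / (2 * \<kappa> \<mu>0)) * dt \<ge> 1/2"

definition mean_error :: "('v \<Rightarrow> 'h::real_normed_vector) \<Rightarrow> real \<Rightarrow> nat \<Rightarrow> (real \<Rightarrow> 'v::real_vector) \<Rightarrow>
    (nat \<Rightarrow> 'v) \<Rightarrow> real" where
  "mean_error \<iota> T m u U =
     sqrt (1 / real m * (\<Sum>k=1..m. (norm (\<iota> (u (tgrid T m k)) - \<iota> (U k)))\<^sup>2))"

end

theory Submission
  imports Defs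
begin

text \<open>
  The error of the reduced solution at \<open>\<mu>1\<close> is compared with the one at \<open>\<mu>0\<close> through
  \<open>u\<^sub>1(t\<^sub>k) - U\<^sub>k\<^sup>1 = (u\<^sub>0(t\<^sub>k) - U\<^sub>k\<^sup>0) + (u\<^sub>1(t\<^sub>k) - u\<^sub>0(t\<^sub>k)) - (U\<^sub>k\<^sup>1 - U\<^sub>k\<^sup>0)\<close>,
  so it suffices that a change of the parameter by \<open>\<delta>\<close> moves the exact solution and the reduced
  solution by at most a constant times \<open>\<omega>_a \<delta> + \<omega>_F \<delta>\<close> in H, uniformly in time
  (\<open>parameter_stability_continuous\<close>, \<open>parameter_stability_discrete\<close>).

  Both facts are one energy argument. Let \<open>w\<close> be the difference of the two solutions. Its time
  derivative, or backward difference quotient, is the difference of the residuals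
  \<open>f - a(x, \<cdot>) - F x\<close> at the two parameters. Tested with \<open>w\<close> itself this gives the coercive term
  \<open>- \<kappa> |w|\<^sub>V\<^sup>2\<close>, a Lipschitz term \<open>L |w|\<^sub>V |w|\<^sub>H\<close>, and a parameter defect that is evaluated at the
  solution for \<open>\<mu>0\<close> and hence is at most a multiple of \<open>(\<omega>_a \<delta> + \<omega>_F \<delta>) (|x0|\<^sub>V + 1) |w|\<^sub>V\<close>
  (\<open>residual_diff_bound\<close>). Young's inequality and Gronwall's lemma, in a continuous and an implicit
  discrete form with the same constants, bound \<open>|w|\<^sub>H\<close> by the \<open>L\<^sup>2\<close> norm in time of the defect,
  because \<open>w\<close> starts from zero. That norm is uniformly finite since the same energy argument for a
  single solution bounds its \<open>L\<^sup>2(0,T;V)\<close> norm by the data alone (\<open>state_bound_continuous\<close>,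
  \<open>state_bound_discrete\<close>). In the discrete case \<open>w\<close> is an admissible test function because both
  reduced solutions live in the same space \<open>V\<^sup>\<ell>\<close>, and the time step condition keeps the factor
  \<open>1 - (L\<^sup>2 / \<kappa>) \<Delta>t\<close> of the implicit Gronwall lemma at least 1/2.

  The energy argument for the exact solution needs a genuine time derivative, whereas a solution
  is given by a weak one. For a solution that is continuous with values in V the residual is
  continuous in time, so the du Bois-Reymond lemma makes the residual, tested with \<open>\<psi>\<close> in V, the
  classical derivative of \<open>t \<mapsto> \<langle>u t, \<psi>\<rangle>\<^sub>H\<close> (\<open>solves_DERIV\<close>), and a mean value
  argument turns this into the derivative of the squared H-norm (\<open>energy_DERIV\<close>).
\<close>

section \<open>Smooth functions on the real line\<close>

text \<open>
  The differentiability required of a \<open>test_function\<close>, without the condition on its support.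
\<close>

definition smooth :: "(real \<Rightarrow> real) \<Rightarrow> bool" where
  "smooth f \<longleftrightarrow> (\<forall>n t. ((deriv ^^ n) f) differentiable (at t))"

text \<open>
  Smoothness is shown throughout by naming a family of functions that is closed under
  differentiation; no formula for a higher derivative is ever computed.
\<close>

lemma smooth_coinduct:
  assumes "f \<in> S"
    and "\<And>g. g \<in> S \<Longrightarrow> \<exists>g'\<in>S. \<forall>x. (g has_real_derivative g' x) (at x)"
  shows "smooth f"
proof -
  have "\<forall>f\<in>S. \<forall>t. ((deriv ^^ n) f) differentiable (at t)" for n
  proof (induction n)
    case 0
    then show ?case using assms(2) real_differentiable_def by fastforce
  next
    case (Suc n)
    show ?case
    proof
      fix g assume "g \<in> S"
      then obtain g' where g': "g' \<in> S" "\<And>x. (g has_real_derivative g' x) (at x)"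
        using assms(2) by blast
      then have "deriv g = g'" by (auto intro: DERIV_imp_deriv)
      with Suc g'(1) show "\<forall>t. ((deriv ^^ Suc n) g) differentiable (at t)"
        by (simp add: funpow_Suc_right del: funpow.simps)
    qed
  qed
  with assms(1) show ?thesis by (simp add: smooth_def)
qed

lemma smooth_DERIV:
  assumes "smooth f"
  shows "(f has_real_derivative deriv f x) (at x)"
proof -
  have "((deriv ^^ 0) f) differentiable (at x)" using assms unfolding smooth_def by blast
  then show ?thesis by (simp add: DERIV_deriv_iff_real_differentiable)
qed

lemma smooth_deriv: "smooth f \<Longrightarrow> smooth (deriv f)"
  unfolding smooth_def by (metis comp_apply funpow_Suc_right)

lemma smooth_continuous_on: "smooth f \<Longrightarrow> continuous_on A f"
  by (meson DERIV_isCont continuous_at_imp_continuous_on smooth_DERIV)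

lemma smooth_antiderivative:
  assumes "\<And>x. (f has_real_derivative g x) (at x)" "smooth g"
  shows "smooth f"
proof (rule smooth_coinduct)
  show "f \<in> insert f (Collect smooth)" by simp
next
  fix h assume "h \<in> insert f (Collect smooth)"
  then show "\<exists>h'\<in>insert f (Collect smooth). \<forall>x. (h has_real_derivative h' x) (at x)"
  proof
    assume "h = f"
    with assms show ?thesis by blast
  next
    assume "h \<in> Collect smooth"
    then show ?thesis by (intro bexI[of _ "deriv h"]) (auto intro: smooth_DERIV smooth_deriv)
  qed
qed

lemma smooth_diff:
  assumes "smooth f" "smooth g"
  shows "smooth (\<lambda>x. f x - g x)"
proof (rule smooth_coinduct)
  show "(\<lambda>x. f x - g x) \<in> {\<lambda>x. f x - g x |f g. smooth f \<and> smooth g}"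
    using assms by blast
next
  fix h assume "h \<in> {\<lambda>x. f x - g x |f g. smooth f \<and> smooth g}"
  then obtain f g where h: "h = (\<lambda>x. f x - g x)" "smooth f" "smooth g" by blast
  show "\<exists>h'\<in>{\<lambda>x. f x - g x |f g. smooth f \<and> smooth g}. \<forall>x. (h has_real_derivative h' x) (at x)"
    by (rule bexI[of _ "\<lambda>x. deriv f x - deriv g x"])
       (use h smooth_deriv in \<open>auto intro!: DERIV_diff smooth_DERIV\<close>)
qed

lemma smooth_affine:
  assumes "smooth f"
  shows "smooth (\<lambda>x. f (c * x + d))"
proof (rule smooth_coinduct)
  show "(\<lambda>x. f (c * x + d)) \<in> {\<lambda>x. k * f (c * x + d) |k f. smooth f}"
    using assms by (intro CollectI exI[of _ 1] exI[of _ f]) auto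
next
  fix h assume "h \<in> {\<lambda>x. k * f (c * x + d) |k f. smooth f}"
  then obtain k f where h: "h = (\<lambda>x. k * f (c * x + d))" "smooth f" by blast
  have "(h has_real_derivative (k * c) * deriv f (c * x + d)) (at x)" for x
    unfolding h(1)
  proof -
    have "((\<lambda>x. c * x + d) has_real_derivative c) (at x)" by (auto intro!: derivative_eq_intros)
    from DERIV_cmult[OF DERIV_chain2[OF smooth_DERIV[OF h(2)] this], of k]
    show "((\<lambda>x. k * f (c * x + d)) has_real_derivative (k * c) * deriv f (c * x + d)) (at x)"
      by (simp add: ac_simps)
  qed
  moreover have "(\<lambda>x. (k * c) * deriv f (c * x + d)) \<in> {\<lambda>x. k * f (c * x + d) |k f. smooth f}"
    using smooth_deriv[OF h(2)] by blast
  ultimately show "\<exists>h'\<in>{\<lambda>x. k * f (c * x + d) |k f. smooth f}. \<forall>x. (h has_real_derivative h' x) (at x)"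
    by (intro bexI[where x="\<lambda>x. (k * c) * deriv f (c * x + d)"] allI)
qed

text \<open>
  The derivative of a product is a sum of products, so the products alone are not closed under
  differentiation, but their sums are.
\<close>

inductive_set smooth_products :: "(real \<Rightarrow> real) set" where
  prod: "smooth f \<Longrightarrow> smooth g \<Longrightarrow> (\<lambda>x. f x * g x) \<in> smooth_products"
| sum: "h \<in> smooth_products \<Longrightarrow> k \<in> smooth_products \<Longrightarrow> (\<lambda>x. h x + k x) \<in> smooth_products"

lemma smooth_mult:
  assumes "smooth f" "smooth g"
  shows "smooth (\<lambda>x. f x * g x)"
proof (rule smooth_coinduct)
  show "(\<lambda>x. f x * g x) \<in> smooth_products" using assms by (rule smooth_products.prod)
next
  fix h assume "h \<in> smooth_products"
  then show "\<exists>h'\<in>smooth_products. \<forall>x. (h has_real_derivative h' x) (at x)"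
  proof induction
    case (prod f g)
    have "(\<lambda>x. deriv f x * g x + deriv g x * f x) \<in> smooth_products"
      using prod by (intro smooth_products.intros smooth_deriv)
    moreover have "\<forall>x. ((\<lambda>x. f x * g x) has_real_derivative deriv f x * g x + deriv g x * f x) (at x)"
      using prod by (intro allI DERIV_mult smooth_DERIV)
    ultimately show ?case by (intro bexI[where x="\<lambda>x. deriv f x * g x + deriv g x * f x"])
  next
    case (sum h k)
    then obtain h' k' where "h' \<in> smooth_products" "k' \<in> smooth_products"
      "\<forall>x. (h has_real_derivative h' x) (at x)" "\<forall>x. (k has_real_derivative k' x) (at x)"
      by blast
    then show ?case
      by (intro bexI[where x="\<lambda>x. h' x + k' x"] allI DERIV_add smooth_products.sum) auto
  qed
qed

section \<open>A smooth step function\<close>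

text \<open>
  The powers of \<open>x\<close> in the denominator make the family closed, up to linear combinations, under
  differentiation.
\<close>

definition flat_exp :: "nat \<Rightarrow> real \<Rightarrow> real" where
  "flat_exp k x = (if x > 0 then exp (- (1 / x)) / x ^ k else 0)"

text \<open>
  This is what makes the glued function differentiable at the origin: the difference quotient of
  \<open>flat_exp k\<close> there is \<open>flat_exp (k + 1)\<close>.
\<close>

lemma flat_exp_tendsto_0: "(flat_exp k \<longlongrightarrow> 0) (at 0)"
proof -
  have "((\<lambda>x. inverse x ^ k / exp (inverse x)) \<longlongrightarrow> (0::real)) (at_right 0)"
    by (rule filterlim_compose[OF tendsto_power_div_exp_0 filterlim_inverse_at_top_right])
  moreover have "\<forall>\<^sub>F x in at_right 0. inverse x ^ k / exp (inverse x) = flat_exp k x"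
    unfolding eventually_at_filter
    by (intro always_eventually) (auto simp: flat_exp_def exp_minus field_simps)
  ultimately have "(flat_exp k \<longlongrightarrow> 0) (at_right 0)" by (rule Lim_transform_eventually)
  moreover have "(flat_exp k \<longlongrightarrow> 0) (at_left 0)"
  proof (rule Lim_transform_eventually)
    show "((\<lambda>x. 0::real) \<longlongrightarrow> 0) (at_left (0::real))" by simp
    show "\<forall>\<^sub>F x in at_left 0. 0 = flat_exp k x"
      unfolding eventually_at_filter by (intro always_eventually) (auto simp: flat_exp_def)
  qed
  ultimately show ?thesis by (simp add: filterlim_split_at)
qed

lemma flat_exp_DERIV:
  "(flat_exp k has_real_derivative flat_exp (k + 2) x - real k * flat_exp (k + 1) x) (at x)"
proof -
  consider "x < 0" | "x = 0" | "x > 0" by linarith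
  then show ?thesis
  proof cases
    case 1
    have "((\<lambda>x. 0) has_real_derivative 0) (at x)" by simp
    then have "(flat_exp k has_real_derivative 0) (at x)"
      by (rule DERIV_cong_ev[THEN iffD1, rotated -1])
         (use 1 in \<open>auto simp: flat_exp_def eventually_nhds intro!: exI[of _ "{..<0}"]\<close>)
    with 1 show ?thesis by (simp add: flat_exp_def)
  next
    case 2
    have "((\<lambda>h. (flat_exp k (0 + h) - flat_exp k 0) / h) \<longlongrightarrow> 0) (at 0)"
      by (rule Lim_transform_eventually[OF flat_exp_tendsto_0[of "k + 1"]])
         (auto simp: flat_exp_def eventually_at_filter)
    then show ?thesis using 2 by (simp add: DERIV_def flat_exp_def)
  next
    case 3
    have "((\<lambda>x. exp (- (1 / x)) / x ^ k) has_real_derivative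
            flat_exp (k + 2) x - real k * flat_exp (k + 1) x) (at x)"
      using 3
      apply (auto intro!: derivative_eq_intros simp: flat_exp_def)
      apply (cases k)
      apply (auto simp: field_simps power2_eq_square)
      done
    then show ?thesis
      by (rule DERIV_cong_ev[THEN iffD1, rotated -1])
         (use 3 in \<open>auto simp: flat_exp_def eventually_nhds intro!: exI[of _ "{0<..}"]\<close>)
  qed
qed

inductive_set flat_exps :: "(real \<Rightarrow> real) set" where
  base: "(\<lambda>x. c * flat_exp k x) \<in> flat_exps"
| sum: "f \<in> flat_exps \<Longrightarrow> g \<in> flat_exps \<Longrightarrow> (\<lambda>x. f x + g x) \<in> flat_exps"

lemma smooth_flat_exp: "smooth (flat_exp k)"
proof (rule smooth_coinduct)
  show "flat_exp k \<in> flat_exps" using flat_exps.base[of 1 k] by simp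
next
  fix g assume "g \<in> flat_exps"
  then show "\<exists>g'\<in>flat_exps. \<forall>x. (g has_real_derivative g' x) (at x)"
  proof induction
    case (base c k)
    have "\<forall>x. ((\<lambda>x. c * flat_exp k x) has_real_derivative
                 c * flat_exp (k + 2) x + (- (c * real k)) * flat_exp (k + 1) x) (at x)"
      by (auto intro!: derivative_eq_intros flat_exp_DERIV simp: algebra_simps)
    moreover have "(\<lambda>x. c * flat_exp (k + 2) x + (- (c * real k)) * flat_exp (k + 1) x) \<in> flat_exps"
      by (intro flat_exps.intros)
    ultimately show ?case
      by (intro bexI[where x="\<lambda>x. c * flat_exp (k + 2) x + (- (c * real k)) * flat_exp (k + 1) x"])
  next
    case (sum f g)
    then obtain f' g' where "f' \<in> flat_exps" "g' \<in> flat_exps"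
      "\<forall>x. (f has_real_derivative f' x) (at x)" "\<forall>x. (g has_real_derivative g' x) (at x)"
      by blast
    then show ?case
      by (intro bexI[where x="\<lambda>x. f' x + g' x"] allI DERIV_add flat_exps.sum) auto
  qed
qed

text \<open>
  The bump \<open>b\<close> is the product of two copies of \<open>flat_exp 0\<close> facing each other, and the step \<open>\<Phi>\<close> is
  its primitive.
\<close>

lemma ex_smooth_step:
  obtains \<Phi> b :: "real \<Rightarrow> real"
  where "smooth \<Phi>" "\<And>x. (\<Phi> has_real_derivative b x) (at x)"
    "\<And>x. 0 < x \<Longrightarrow> x < 1 \<Longrightarrow> b x > 0" "\<And>x. x \<notin> {0<..<1} \<Longrightarrow> b x = 0"
    "\<And>x. x \<le> 0 \<Longrightarrow> \<Phi> x = 0" "\<And>x. x \<ge> 1 \<Longrightarrow> \<Phi> x = \<Phi> 1"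
proof -
  define b where "b x = flat_exp 0 x * flat_exp 0 (-1 * x + 1)" for x
  have b: "smooth b" unfolding b_def by (intro smooth_mult smooth_affine smooth_flat_exp)
  have b0: "b x = 0" if "x \<notin> {0<..<1}" for x using that by (auto simp: b_def flat_exp_def)
  define \<Phi> where "\<Phi> x = integral {0..x} b" for x
  have D: "(\<Phi> has_real_derivative b x) (at x)" for x
  proof -
    \<comment> \<open>As b vanishes on the negative axis, the integral may start to the left of x; the fundamental theorem then applies at negative x too.\<close>
    have eq: "\<Phi> y = integral {x-1-\<bar>x\<bar>..y} b" if "y > x - 1 - \<bar>x\<bar>" for y
    proof (cases "y \<ge> 0")
      case True
      have "integral {x-1-\<bar>x\<bar>..0} b + integral {0..y} b = integral {x-1-\<bar>x\<bar>..y} b"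
        by (rule Henstock_Kurzweil_Integration.integral_combine)
           (use True b in \<open>auto intro!: integrable_continuous_interval smooth_continuous_on\<close>)
      moreover have "integral {x-1-\<bar>x\<bar>..0} b = integral {x-1-\<bar>x\<bar>..0} (\<lambda>_. 0)"
        by (rule integral_cong) (use b0 in auto)
      ultimately show ?thesis by (simp add: \<Phi>_def)
    next
      case False
      then have "integral {x-1-\<bar>x\<bar>..y} b = integral {x-1-\<bar>x\<bar>..y} (\<lambda>_. 0)"
        by (intro integral_cong) (use b0 in auto)
      with False show ?thesis by (simp add: \<Phi>_def)
    qed
    have "((\<lambda>y. integral {x-1-\<bar>x\<bar>..y} b) has_real_derivative b x) (at x within {x-1-\<bar>x\<bar>..x+1})"
      by (rule integral_has_real_derivative) (use b in \<open>auto intro: smooth_continuous_on\<close>)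
    then have "((\<lambda>y. integral {x-1-\<bar>x\<bar>..y} b) has_real_derivative b x) (at x)"
      by (subst (asm) at_within_interior) auto
    then show ?thesis
      by (rule DERIV_cong_ev[THEN iffD1, rotated -1])
         (use eq in \<open>auto simp: eventually_nhds intro!: exI[of _ "{x-1-\<bar>x\<bar><..}"]\<close>)
  qed
  have \<Phi>0: "\<Phi> x = 0" if "x \<le> 0" for x
    using that by (cases "x = 0") (auto simp: \<Phi>_def)
  have \<Phi>1: "\<Phi> x = \<Phi> 1" if "x \<ge> 1" for x
  proof -
    have "integral {0..1} b + integral {1..x} b = integral {0..x} b"
      by (rule Henstock_Kurzweil_Integration.integral_combine)
         (use that b in \<open>auto intro!: integrable_continuous_interval smooth_continuous_on\<close>)
    moreover have "integral {1..x} b = integral {1..x} (\<lambda>_. 0)"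
      by (rule integral_cong) (use b0 in auto)
    ultimately show ?thesis by (simp add: \<Phi>_def)
  qed
  have b_pos: "b x > 0" if "0 < x" "x < 1" for x using that by (auto simp: b_def flat_exp_def)
  show thesis
    by (rule that[OF smooth_antiderivative[OF D b] D b_pos b0 \<Phi>0 \<Phi>1])
qed

section \<open>The du Bois-Reymond lemma for continuous functions\<close>

text \<open>
  If \<open>\<xi> s < c < \<xi> t\<close>, take a test function that climbs just to the right of \<open>s\<close>, where \<open>\<xi> < c\<close>, and
  descends by the same amount just to the right of \<open>t\<close>, where \<open>\<xi> > c\<close>. Then \<open>\<eta>' (c - \<xi>)\<close> is
  nonnegative. Its integral is zero, because both \<open>\<eta>'\<close> and \<open>\<eta>' \<xi>\<close> integrate to zero, so it vanishes
  identically, which fails at a point just to the right of \<open>s\<close>.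
\<close>

lemma weakly_constant_imp_le:
  fixes \<xi> :: "real \<Rightarrow> real"
  assumes cont: "continuous_on {0..T} \<xi>"
    and weak: "\<And>\<eta>. test_function T \<eta> \<Longrightarrow> integral {0..T} (\<lambda>t. deriv \<eta> t * \<xi> t) = 0"
    and s: "s \<in> {0<..<T}" and t: "t \<in> {0<..<T}"
  shows "\<xi> t \<le> \<xi> s"
proof (rule ccontr)
  assume "\<not> \<xi> t \<le> \<xi> s"
  define c where "c = (\<xi> s + \<xi> t) / 2"
  have c: "\<xi> s < c" "c < \<xi> t" using \<open>\<not> \<xi> t \<le> \<xi> s\<close> by (auto simp: c_def)
  have isC: "isCont \<xi> x" if "x \<in> {0<..<T}" for x
    using cont that by (metis at_within_Icc_at continuous_on_eq_continuous_within
        greaterThanLessThan_iff greaterThanLessThan_subseteq_atLeastAtMost_iff order_refl subsetD)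
  have "\<forall>\<^sub>F x in nhds s. \<xi> x < c"
    using isC[OF s] c(1) by (metis order_tendstoD(2) isCont_def tendsto_at_iff_tendsto_nhds)
  then obtain d1 where d1: "d1 > 0" "\<And>x. dist x s < d1 \<Longrightarrow> \<xi> x < c"
    by (auto simp: eventually_nhds_metric)
  have "\<forall>\<^sub>F x in nhds t. \<xi> x > c"
    using isC[OF t] c(2) by (metis order_tendstoD(1) isCont_def tendsto_at_iff_tendsto_nhds)
  then obtain d2 where d2: "d2 > 0" "\<And>x. dist x t < d2 \<Longrightarrow> \<xi> x > c"
    by (auto simp: eventually_nhds_metric)
  define \<epsilon> where "\<epsilon> = min (min d1 d2) (min (T - s) (T - t)) / 2"
  have \<epsilon>: "\<epsilon> > 0" "\<epsilon> < d1" "\<epsilon> < d2" "s + \<epsilon> < T" "t + \<epsilon> < T"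
    using d1 d2 s t by (auto simp: \<epsilon>_def min_def field_simps)
  obtain \<Phi> b where \<Phi>: "smooth \<Phi>" "\<And>x. (\<Phi> has_real_derivative b x) (at x)"
    "\<And>x. 0 < x \<Longrightarrow> x < 1 \<Longrightarrow> b x > 0" "\<And>x. x \<notin> {0<..<1} \<Longrightarrow> b x = 0"
    "\<And>x. x \<le> 0 \<Longrightarrow> \<Phi> x = 0" "\<And>x. x \<ge> 1 \<Longrightarrow> \<Phi> x = \<Phi> (1::real)"
    using ex_smooth_step by metis
  define S where "S r x = (1/\<epsilon>) * x + (- r / \<epsilon>)" for r x
  have S: "S r x = (x - r) / \<epsilon>" for r x by (simp add: S_def diff_divide_distrib)
  define \<eta> where "\<eta> x = \<Phi> (S s x) - \<Phi> (S t x)" for x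
  define \<eta>' where "\<eta>' x = (b (S s x) - b (S t x)) / \<epsilon>" for x
  have sm: "smooth \<eta>" unfolding \<eta>_def S_def by (intro smooth_diff smooth_affine \<Phi>)
  have D\<eta>: "(\<eta> has_real_derivative \<eta>' x) (at x)" for x
    unfolding \<eta>_def \<eta>'_def S_def
    by (rule derivative_eq_intros DERIV_chain2[OF \<Phi>(2)] refl | simp add: diff_divide_distrib)+
  then have d\<eta>: "deriv \<eta> = \<eta>'" by (auto intro: DERIV_imp_deriv)
  have supp: "\<eta> x = 0" if "x \<notin> {min s t..max s t + \<epsilon>}" for x
  proof -
    consider "x \<le> s \<and> x \<le> t" | "x \<ge> s + \<epsilon> \<and> x \<ge> t + \<epsilon>" using \<open>x \<notin> _\<close> by force
    then show ?thesis
    proof cases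
      case 1
      then have "S s x \<le> 0" "S t x \<le> 0" using \<epsilon>(1) by (auto simp: S divide_le_0_iff)
      then show ?thesis by (simp add: \<eta>_def \<Phi>)
    next
      case 2
      then have "S s x \<ge> 1" "S t x \<ge> 1" using \<epsilon>(1) by (auto simp: S)
      then show ?thesis using \<Phi>(6) by (metis \<eta>_def diff_self)
    qed
  qed
  have "closure {x. \<eta> x \<noteq> 0} \<subseteq> {min s t..max s t + \<epsilon>}"
    by (rule closure_minimal) (use supp in blast, simp)
  also have "\<dots> \<subseteq> {0<..<T}" using s t \<epsilon> by auto
  finally have tf: "test_function T \<eta>" using sm unfolding test_function_def smooth_def by blast
  have \<eta>0: "\<eta> 0 = 0" "\<eta> T = 0" using supp[of 0] supp[of T] s t \<epsilon> by (auto simp: max_def min_def split: if_splits)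
  have T: "0 \<le> T" using s by auto
  have c\<eta>': "continuous_on {0..T} \<eta>'"
    using smooth_continuous_on[OF smooth_deriv[OF sm]] by (simp add: d\<eta>)
  have "(\<eta>' has_integral \<eta> T - \<eta> 0) {0..T}"
    by (rule fundamental_theorem_of_calculus[OF T])
       (meson D\<eta> has_field_derivative_at_within has_real_derivative_iff_has_vector_derivative)
  then have i0: "integral {0..T} \<eta>' = 0" using \<eta>0 by (simp add: integral_unique)
  define h where "h x = \<eta>' x * (c - \<xi> x)" for x
  have "integral {0..T} h = integral {0..T} (\<lambda>x. \<eta>' x * c) - integral {0..T} (\<lambda>x. \<eta>' x * \<xi> x)"
    unfolding h_def right_diff_distrib
    by (intro Henstock_Kurzweil_Integration.integral_diff integrable_continuous_interval
        continuous_intros c\<eta>' cont)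
  then have ih: "integral {0..T} h = 0" using weak[OF tf] i0 by (simp add: d\<eta>)
  have h_nonneg: "h x \<ge> 0" for x
  proof -
    have "b y \<ge> 0" for y using \<Phi>(3)[of y] \<Phi>(4)[of y] by force
    moreover have "c - \<xi> x > 0" if "b (S s x) \<noteq> 0"
    proof -
      have "S s x \<in> {0<..<1}" using that \<Phi>(4) by blast
      then have "dist x s < d1" using \<epsilon> by (auto simp: S dist_real_def field_simps)
      then show ?thesis using d1 by simp
    qed
    moreover have "c - \<xi> x < 0" if "b (S t x) \<noteq> 0"
    proof -
      have "S t x \<in> {0<..<1}" using that \<Phi>(4) by blast
      then have "dist x t < d2" using \<epsilon> by (auto simp: S dist_real_def field_simps)
      then show ?thesis using d2 by simp
    qed
    ultimately have "b (S s x) * (c - \<xi> x) \<ge> 0" "b (S t x) * (c - \<xi> x) \<le> 0"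
      by (metis less_eq_real_def mult_eq_0_iff mult_nonneg_nonneg,
          metis less_eq_real_def mult_eq_0_iff mult_nonneg_nonpos)
    then show ?thesis using \<epsilon>(1) by (simp add: h_def \<eta>'_def left_diff_distrib)
  qed
  have "h x = 0" if "x \<in> {0..T}" for x
  proof -
    have "continuous_on {0..T} h" unfolding h_def by (intro continuous_intros c\<eta>' cont)
    then show ?thesis using integral_eq_0_iff[of 0 T h] ih h_nonneg s that by auto
  qed
  moreover have "h (s + \<epsilon>/2) > 0"
  proof -
    have 1: "\<xi> (s + \<epsilon>/2) < c" using d1 \<epsilon> by (auto simp: dist_real_def)
    have 2: "b (S s (s + \<epsilon>/2)) > 0" using \<Phi>(3) \<epsilon> by (auto simp: S)
    have "b (S t (s + \<epsilon>/2)) = 0"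
    proof (rule ccontr)
      assume "b (S t (s + \<epsilon>/2)) \<noteq> 0"
      then have "S t (s + \<epsilon>/2) \<in> {0<..<1}" using \<Phi>(4) by blast
      then have "dist (s + \<epsilon>/2) t < d2" using \<epsilon> by (auto simp: S dist_real_def field_simps)
      then show False using d2 1 by force
    qed
    with 1 2 \<epsilon> show ?thesis by (simp add: h_def \<eta>'_def)
  qed
  moreover have "s + \<epsilon>/2 \<in> {0..T}" using s \<epsilon> by auto
  ultimately show False by fastforce
qed

text \<open>
  Subtracting a primitive of \<open>r\<close> from \<open>\<zeta>\<close> leaves a function whose weak derivative is zero.
\<close>

lemma weak_derivative_continuous:
  fixes \<zeta> r :: "real \<Rightarrow> real"
  assumes cont: "continuous_on {0..T} \<zeta>" "continuous_on {0..T} r"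
    and weak: "\<And>\<eta>. test_function T \<eta> \<Longrightarrow>
      integral {0..T} (\<lambda>t. deriv \<eta> t * \<zeta> t) = - integral {0..T} (\<lambda>t. \<eta> t * r t)"
    and t: "t \<in> {0<..<T}"
  shows "(\<zeta> has_real_derivative r t) (at t)"
proof -
  define R where "R x = integral {0..x} r" for x
  have DR: "(R has_real_derivative r x) (at x within {0..T})" if "x \<in> {0..T}" for x
    unfolding R_def using integral_has_real_derivative[OF cont(2)] that by blast
  have cR: "continuous_on {0..T} R"
    by (rule DERIV_continuous_on[OF DR])
  define \<xi> where "\<xi> x = \<zeta> x - R x" for x
  have c\<xi>: "continuous_on {0..T} \<xi>" unfolding \<xi>_def by (intro continuous_intros cont cR)
  have w\<xi>: "integral {0..T} (\<lambda>t. deriv \<eta> t * \<xi> t) = 0" if tf: "test_function T \<eta>" for \<eta>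
  proof -
    have sm: "smooth \<eta>" using tf by (simp add: test_function_def smooth_def)
    have "0 \<notin> closure {t. \<eta> t \<noteq> 0}" "T \<notin> closure {t. \<eta> t \<noteq> 0}"
      using tf by (auto simp: test_function_def)
    then have \<eta>0: "\<eta> 0 = 0" "\<eta> T = 0"
      using closure_subset[of "{t. \<eta> t \<noteq> 0}"] by (metis (mono_tags) mem_Collect_eq subsetD)+
    have c: "continuous_on {0..T} \<eta>" "continuous_on {0..T} (deriv \<eta>)"
      using sm smooth_deriv smooth_continuous_on by auto
    have "((\<lambda>x. deriv \<eta> x * R x + r x * \<eta> x) has_integral \<eta> T * R T - \<eta> 0 * R 0) {0..T}"
      using t
      by (intro fundamental_theorem_of_calculus)
         (auto simp flip: has_real_derivative_iff_has_vector_derivative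
           intro!: DERIV_mult DR has_field_derivative_at_within[OF smooth_DERIV[OF sm]])
    then have "integral {0..T} (\<lambda>x. deriv \<eta> x * R x + r x * \<eta> x) = 0"
      using \<eta>0 by (simp add: integral_unique)
    then have "integral {0..T} (\<lambda>x. deriv \<eta> x * R x) = - integral {0..T} (\<lambda>x. \<eta> x * r x)"
      by (subst (asm) Henstock_Kurzweil_Integration.integral_add)
         (auto intro!: integrable_continuous_interval continuous_intros c cont cR simp: mult.commute)
    then show ?thesis
      unfolding \<xi>_def right_diff_distrib
      by (subst Henstock_Kurzweil_Integration.integral_diff)
         (auto intro!: integrable_continuous_interval continuous_intros c cont cR simp: weak[OF tf])
  qed
  have "\<xi> x = \<xi> t" if "x \<in> {0<..<T}" for x
    by (intro antisym weakly_constant_imp_le[OF c\<xi> w\<xi>] that t)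
  then have eq: "\<zeta> x = \<xi> t + R x" if "x \<in> {0<..<T}" for x
    using that unfolding \<xi>_def by (metis diff_add_cancel)
  have "(R has_real_derivative r t) (at t)"
    using DR[of t] t by (auto simp: at_within_Icc_at)
  then have "((\<lambda>x. \<xi> t + R x) has_real_derivative r t) (at t)"
    by (auto intro!: derivative_eq_intros)
  then show ?thesis
    by (rule DERIV_cong_ev[THEN iffD1, rotated -1])
       (use eq t in \<open>auto simp: eventually_nhds intro!: exI[of _ "{0<..<T}"]\<close>)
qed

section \<open>Time derivatives along solutions\<close>

text \<open>
  The functional that drives both the evolution equation and the backward Euler scheme: in either
  case the H-product of the rate of change with \<open>\<psi>\<close> equals the residual tested with \<open>\<psi>\<close>.
\<close>

definition residual ::
  "('v::real_inner \<Rightarrow> 'h::real_inner) \<Rightarrow> ('v \<Rightarrow> 'v \<Rightarrow> real) \<Rightarrow> ('v \<Rightarrow> 'h) \<Rightarrow> 'h \<Rightarrow> 'v \<Rightarrow> 'v \<Rightarrow> real" where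
  "residual \<iota> A G h x \<psi> = inner h (\<iota> \<psi>) - A x \<psi> - inner (G x) (\<iota> \<psi>)"

lemma set_lebesgue_integral_continuous:
  fixes h :: "real \<Rightarrow> real"
  assumes "continuous_on {0..T} h"
  shows "set_lebesgue_integral lborel {0<..<T} h = integral {0..T} h"
proof -
  have "set_integrable lborel {0..T} h"
    by (rule borel_integrable_atLeastAtMost'[OF assms])
  then have "set_integrable lborel {0<..<T} h"
    by (rule set_integrable_subset) auto
  then show ?thesis
    by (simp add: set_borel_integral_eq_integral integral_open_interval_real)
qed

text \<open>
  Continuity of \<open>u\<close> with values in V makes the residual continuous in time. By injectivity of the
  embedding, \<open>u\<close> agrees almost everywhere with the V-valued representative of the solution, so the
  residual is a weak derivative of \<open>s \<mapsto> inner (\<iota> (u s)) (\<iota> \<psi>)\<close>.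
\<close>

lemma solves_DERIV:
  fixes \<iota> :: "'v::{real_inner, banach, second_countable_topology} \<Rightarrow>
              'h::{real_inner, banach, second_countable_topology}"
  assumes \<iota>: "bounded_linear \<iota>" "inj \<iota>"
    and sol: "solves \<iota> T A G f \<phi> (\<lambda>t. \<iota> (u t))"
    and cont: "continuous_on {0..T} u" "continuous_on {0..T} f"
    and A: "bounded_bilinear A" and G: "continuous_on UNIV G"
    and t: "t \<in> {0<..<T}"
  shows "((\<lambda>s. inner (\<iota> (u s)) (\<iota> \<psi>)) has_real_derivative residual \<iota> A G (f t) (u t) \<psi>) (at t)"
proof (rule weak_derivative_continuous[OF _ _ _ t])
  have c\<iota>: "continuous_on UNIV \<iota>" using \<iota>(1) by (simp add: linear_continuous_on)
  show c\<zeta>: "continuous_on {0..T} (\<lambda>s. inner (\<iota> (u s)) (\<iota> \<psi>))"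
    by (intro continuous_intros continuous_on_compose2[OF c\<iota> cont(1)]) auto
  show cr: "continuous_on {0..T} (\<lambda>s. residual \<iota> A G (f s) (u s) \<psi>)"
    unfolding residual_def
    by (intro continuous_intros cont continuous_on_compose2[OF G cont(1)]
        bounded_bilinear.continuous_on[OF A]) auto
  obtain v g where vg: "W_derivative \<iota> T v g"
    and v: "AE t in lborel. t \<in> {0<..<T} \<longrightarrow> \<iota> (u t) = \<iota> (v t)"
    and g: "\<And>\<psi>. AE t in lborel. t \<in> {0<..<T} \<longrightarrow>
           blinfun_apply (g t) \<psi> + A (v t) \<psi> + inner (G (v t)) (\<iota> \<psi>) = inner (f t) (\<iota> \<psi>)"
    using sol unfolding solves_def by blast
  fix \<eta> assume \<eta>: "test_function T \<eta>"
  then have sm: "smooth \<eta>" by (simp add: test_function_def smooth_def)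
  have c\<eta>: "continuous_on S \<eta>" "continuous_on S (deriv \<eta>)" for S
    using sm smooth_deriv smooth_continuous_on by auto
  have m\<eta>: "\<eta> \<in> borel_measurable borel" "deriv \<eta> \<in> borel_measurable borel"
    using c\<eta> by (auto intro: borel_measurable_continuous_onI)
  \<comment> \<open>Measurability of v and g is known only on the interval, hence the indicators inside the maps.\<close>
  have vm: "(\<lambda>t. indicator {0<..<T} t *\<^sub>R v t) \<in> borel_measurable lborel"
    and gm: "(\<lambda>t. indicator {0<..<T} t *\<^sub>R g t) \<in> borel_measurable lborel"
    using vg by (auto simp: W_derivative_def L2_on_def set_borel_measurable_def)
  have "(\<lambda>x. inner (\<iota> x) (\<iota> \<psi>)) \<in> borel_measurable borel"
    by (intro borel_measurable_continuous_onI continuous_intros c\<iota>)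
  from measurable_compose[OF vm this]
  have "(\<lambda>t. deriv \<eta> t * inner (\<iota> (indicator {0<..<T} t *\<^sub>R v t)) (\<iota> \<psi>)) \<in> borel_measurable lborel"
    using m\<eta> by simp
  moreover have "(\<lambda>t. deriv \<eta> t * inner (\<iota> (indicator {0<..<T} t *\<^sub>R v t)) (\<iota> \<psi>))
      = (\<lambda>t. indicator {0<..<T} t *\<^sub>R (deriv \<eta> t * inner (\<iota> (v t)) (\<iota> \<psi>)))"
    by (simp add: linear_simps[OF \<iota>(1)] fun_eq_iff)
  ultimately have m1: "(\<lambda>t. indicator {0<..<T} t *\<^sub>R (deriv \<eta> t * inner (\<iota> (v t)) (\<iota> \<psi>)))
      \<in> borel_measurable lborel" by simp
  have "(\<lambda>x. blinfun_apply x \<psi>) \<in> borel_measurable borel"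
    by (intro borel_measurable_continuous_onI continuous_intros)
  from measurable_compose[OF gm this]
  have "(\<lambda>t. \<eta> t * blinfun_apply (indicator {0<..<T} t *\<^sub>R g t) \<psi>) \<in> borel_measurable lborel"
    using m\<eta> by simp
  then have m2: "(\<lambda>t. indicator {0<..<T} t *\<^sub>R (\<eta> t * blinfun_apply (g t) \<psi>))
      \<in> borel_measurable lborel" by (simp add: blinfun.scaleR_left mult.left_commute)
  have m3: "(\<lambda>t. indicator {0<..<T} t *\<^sub>R h t) \<in> borel_measurable lborel"
    if "continuous_on {0..T} h" for h :: "real \<Rightarrow> real"
  proof -
    have "continuous_on {0<..<T} h" by (rule continuous_on_subset[OF that]) auto
    then show ?thesis
      using borel_measurable_continuous_on_indicator[of "{0<..<T}" h] by simp
  qed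
  have c1: "continuous_on {0..T} (\<lambda>t. deriv \<eta> t * inner (\<iota> (u t)) (\<iota> \<psi>))"
    and c2: "continuous_on {0..T} (\<lambda>t. \<eta> t * residual \<iota> A G (f t) (u t) \<psi>)"
    by (intro continuous_intros c\<eta> c\<zeta> cr)+
  have "integral {0..T} (\<lambda>t. deriv \<eta> t * inner (\<iota> (u t)) (\<iota> \<psi>))
      = set_lebesgue_integral lborel {0<..<T} (\<lambda>t. deriv \<eta> t * inner (\<iota> (u t)) (\<iota> \<psi>))"
    by (rule set_lebesgue_integral_continuous[OF c1, symmetric])
  also have "\<dots> = set_lebesgue_integral lborel {0<..<T} (\<lambda>t. deriv \<eta> t * inner (\<iota> (v t)) (\<iota> \<psi>))"
    unfolding set_lebesgue_integral_def
    by (rule integral_cong_AE[OF m3[OF c1] m1]) (use v in eventually_elim, auto simp: indicator_def)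
  also have "\<dots> = - set_lebesgue_integral lborel {0<..<T} (\<lambda>t. \<eta> t * blinfun_apply (g t) \<psi>)"
    using vg \<eta> by (simp add: W_derivative_def dual_weak_derivative_def)
  also have "set_lebesgue_integral lborel {0<..<T} (\<lambda>t. \<eta> t * blinfun_apply (g t) \<psi>)
      = set_lebesgue_integral lborel {0<..<T} (\<lambda>t. \<eta> t * residual \<iota> A G (f t) (u t) \<psi>)"
    unfolding set_lebesgue_integral_def
  proof (rule integral_cong_AE[OF m2 m3[OF c2]])
    show "AE t in lborel. indicator {0<..<T} t *\<^sub>R (\<eta> t * blinfun_apply (g t) \<psi>)
        = indicator {0<..<T} t *\<^sub>R (\<eta> t * residual \<iota> A G (f t) (u t) \<psi>)"
      using v g[of \<psi>]
    proof eventually_elim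
      case (elim t)
      show ?case
      proof (cases "t \<in> {0<..<T}")
        case True
        with elim have "u t = v t" using \<iota>(2) by (simp add: inj_eq)
        with True elim have "blinfun_apply (g t) \<psi> = residual \<iota> A G (f t) (u t) \<psi>"
          by (simp add: residual_def algebra_simps)
        then show ?thesis by simp
      qed simp
    qed
  qed
  also have "\<dots> = integral {0..T} (\<lambda>t. \<eta> t * residual \<iota> A G (f t) (u t) \<psi>)"
    by (rule set_lebesgue_integral_continuous[OF c2])
  finally show "integral {0..T} (\<lambda>t. deriv \<eta> t * inner (\<iota> (u t)) (\<iota> \<psi>))
      = - integral {0..T} (\<lambda>t. \<eta> t * residual \<iota> A G (f t) (u t) \<psi>)" .
qed

text \<open>
  With \<open>\<psi> = w s + w t\<close> the difference of the squared norms at \<open>s\<close> and \<open>t\<close> is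
  \<open>inner (\<iota> (w s)) (\<iota> \<psi>) - inner (\<iota> (w t)) (\<iota> \<psi>)\<close>, and the mean value theorem with this \<open>\<psi>\<close> held
  fixed turns the difference quotient into \<open>R z (w s + w t)\<close> for some \<open>z\<close> between \<open>s\<close> and \<open>t\<close>. Joint
  continuity of \<open>R\<close> identifies the limit.
\<close>

lemma energy_DERIV:
  fixes \<iota> :: "'v::real_inner \<Rightarrow> 'h::real_inner"
  assumes \<iota>: "linear \<iota>"
    and w: "continuous_on {0..T} w"
    and D: "\<And>t \<psi>. t \<in> {0<..<T} \<Longrightarrow>
      ((\<lambda>s. inner (\<iota> (w s)) (\<iota> \<psi>)) has_real_derivative R t \<psi>) (at t)"
    and t: "t \<in> {0<..<T}"
    and lim: "\<And>z v v0. (z \<longlongrightarrow> t) (at t) \<Longrightarrow> (v \<longlongrightarrow> v0) (at t) \<Longrightarrow>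
      ((\<lambda>s. R (z s) (v s)) \<longlongrightarrow> R t v0) (at t)"
  shows "((\<lambda>s. (norm (\<iota> (w s)))\<^sup>2) has_real_derivative 2 * R t (w t)) (at t)"
proof -
  define E where "E s = (norm (\<iota> (w s)))\<^sup>2" for s
  have "\<exists>z. z \<in> {0<..<T} \<and> dist z t \<le> dist s t \<and> (E s - E t) / (s - t) = R z (w s + w t)"
    if s: "s \<in> {0<..<T}" "s \<noteq> t" for s
  proof -
    define q where "q x = inner (\<iota> (w x)) (\<iota> (w s + w t))" for x
    have Dq: "(q has_real_derivative R x (w s + w t)) (at x)" if "x \<in> {0<..<T}" for x
      unfolding q_def by (rule D[OF that])
    have E: "E s - E t = q s - q t"
      by (simp add: E_def q_def linear_add[OF \<iota>] power2_norm_eq_inner inner_add_right inner_commute)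
    show ?thesis
    proof (cases "s < t")
      case True
      obtain z where "s < z" "z < t" "q t - q s = (t - s) * R z (w s + w t)"
        using MVT2[OF True, of q "\<lambda>z. R z (w s + w t)"] Dq s t by auto
      then show ?thesis using E s t
        by (intro exI[of _ z]) (auto simp: dist_real_def field_simps)
    next
      case False
      then have "t < s" using s by simp
      then obtain z where "t < z" "z < s" "q s - q t = (s - t) * R z (w s + w t)"
        using MVT2[of t s q "\<lambda>z. R z (w s + w t)"] Dq s t by auto
      then show ?thesis using E s t
        by (intro exI[of _ z]) (auto simp: dist_real_def field_simps)
    qed
  qed
  then obtain z where z: "\<And>s. s \<in> {0<..<T} \<Longrightarrow> s \<noteq> t \<Longrightarrow>
      dist (z s) t \<le> dist s t \<and> (E s - E t) / (s - t) = R (z s) (w s + w t)"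
    by metis
  have near: "\<forall>\<^sub>F s in at t. s \<in> {0<..<T} \<and> s \<noteq> t"
    using t by (auto simp: eventually_at_topological intro!: exI[of _ "{0<..<T}"])
  have zt: "(z \<longlongrightarrow> t) (at t)"
    by (rule metric_tendsto_imp_tendsto[OF tendsto_ident_at])
       (use near in eventually_elim, use z in auto)
  have "isCont w t"
    using w t by (metis at_within_Icc_at continuous_on_eq_continuous_within
        greaterThanLessThan_iff greaterThanLessThan_subseteq_atLeastAtMost_iff order_refl subsetD)
  then have "((\<lambda>s. w s + w t) \<longlongrightarrow> w t + w t) (at t)"
    by (intro tendsto_intros) (simp add: isCont_def)
  from lim[OF zt this] have "((\<lambda>s. (E s - E t) / (s - t)) \<longlongrightarrow> R t (w t + w t)) (at t)"
    by (rule Lim_transform_eventually) (use near in eventually_elim, use z in auto)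
  then have "(E has_real_derivative R t (w t + w t)) (at t)"
    by (simp add: has_field_derivative_iff)
  \<comment> \<open>Doubling the test vector doubles the inner product, hence also its derivative.\<close>
  moreover have "R t (w t + w t) = 2 * R t (w t)"
  proof (rule DERIV_unique[OF D[OF t]])
    have "(\<lambda>s. inner (\<iota> (w s)) (\<iota> (w t + w t))) = (\<lambda>s. 2 * inner (\<iota> (w s)) (\<iota> (w t)))"
      by (simp add: linear_add[OF \<iota>] inner_add_right fun_eq_iff)
    then show "((\<lambda>s. inner (\<iota> (w s)) (\<iota> (w t + w t))) has_real_derivative 2 * R t (w t)) (at t)"
      using DERIV_cmult[OF D[OF t, of "w t"], of 2] by simp
  qed
  ultimately show ?thesis by (simp add: E_def[abs_def])
qed

section \<open>Energy estimates\<close>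

text \<open>
  Of the \<open>2 \<kappa> x\<^sup>2\<close> supplied by coercivity, \<open>\<kappa> / 2 x\<^sup>2\<close> absorbs the data term \<open>2 g x\<close> and \<open>\<kappa> x\<^sup>2\<close> the Lipschitz
  term; the remaining \<open>\<kappa> / 2 x\<^sup>2\<close> is kept to control the V-norm.
\<close>

lemma young_energy:
  fixes r x y g L \<kappa> :: real
  assumes "\<kappa> > 0" "r \<le> - \<kappa> * x\<^sup>2 + g * x + L * x * y"
  shows "2 * r + \<kappa> / 2 * x\<^sup>2 \<le> L\<^sup>2 / \<kappa> * y\<^sup>2 + 2 / \<kappa> * g\<^sup>2"
proof -
  have "0 \<le> (\<kappa> * x - 2 * g)\<^sup>2 / (2 * \<kappa>) + (\<kappa> * x - L * y)\<^sup>2 / \<kappa>"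
    using assms(1) by simp
  also have "\<dots> = (\<kappa> / 2 * x\<^sup>2 - 2 * g * x + 2 / \<kappa> * g\<^sup>2) + (\<kappa> * x\<^sup>2 - 2 * L * x * y + L\<^sup>2 / \<kappa> * y\<^sup>2)"
    using assms(1) by (simp add: power2_eq_square field_simps)
  finally show ?thesis using assms(2) by (simp add: algebra_simps)
qed

text \<open>
  With the integrating factor \<open>exp (- c t)\<close> the inequality becomes the monotonicity of \<open>H\<close>. The
  dissipation is weighted by \<open>\<gamma>\<close>, the least value of the integrating factor on the interval.
\<close>

lemma gronwall_continuous:
  fixes E E' D B :: "real \<Rightarrow> real"
  assumes cont: "continuous_on {0..T} E" "continuous_on {0..T} D" "continuous_on {0..T} B"
    and deriv: "\<And>t. t \<in> {0<..<T} \<Longrightarrow> (E has_real_derivative E' t) (at t)"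
    and ineq: "\<And>t. t \<in> {0<..<T} \<Longrightarrow> E' t + k * D t \<le> c * E t + B t"
    and nonneg: "\<And>t. E t \<ge> 0" "\<And>t. D t \<ge> 0" "\<And>t. B t \<ge> 0" "c \<ge> 0" "k \<ge> 0"
    and t: "t \<in> {0..T}"
  shows "exp (- c * T) * (E t + k * integral {0..t} D) \<le> E 0 + integral {0..t} B"
proof -
  define \<gamma> where "\<gamma> = exp (- c * T)"
  define H where "H s = exp (- c * s) * E s + (\<gamma> * k * integral {0..s} D - integral {0..s} B)" for s
  have int_deriv: "((\<lambda>s. integral {0..s} h) has_real_derivative h s) (at s within {0..T})"
    if "continuous_on {0..T} h" "s \<in> {0..T}" for h :: "real \<Rightarrow> real" and s
    using integral_has_real_derivative that by blast
  have cint: "continuous_on {0..T} (\<lambda>s. integral {0..s} h)" if "continuous_on {0..T} h"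
    for h :: "real \<Rightarrow> real"
    by (rule DERIV_continuous_on[OF int_deriv[OF that]])
  have "H t \<le> H 0"
  proof (rule DERIV_nonpos_imp_decreasing_open[where f = H])
    show "0 \<le> t" using t by simp
    have "continuous_on {0..T} H"
      unfolding H_def by (intro continuous_intros cont cint)
    then show "continuous_on {0..t} H" by (rule continuous_on_subset) (use t in auto)
    fix s assume s: "0 < s" "s < t"
    then have s': "s \<in> {0<..<T}" using t by auto
    have I: "((\<lambda>s. integral {0..s} h) has_real_derivative h s) (at s)"
      if "continuous_on {0..T} h" for h :: "real \<Rightarrow> real"
      using int_deriv[OF that, of s] s' by (simp add: at_within_Icc_at)
    have "(H has_real_derivative
        (exp (- c * s) * (E' s - c * E s) + (\<gamma> * k * D s - B s))) (at s)"
      unfolding H_def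
      by (rule derivative_eq_intros I cont deriv s' refl | simp add: algebra_simps)+
    moreover have "exp (- c * s) * (E' s - c * E s) + (\<gamma> * k * D s - B s) \<le> 0"
    proof -
      have "exp (- c * s) * (E' s - c * E s) \<le> exp (- c * s) * (B s - k * D s)"
        using ineq[OF s'] by (intro mult_left_mono) auto
      moreover have "exp (- c * s) * B s \<le> B s"
        using nonneg s' by (simp add: mult_left_le_one_le)
      moreover have "\<gamma> * (k * D s) \<le> exp (- c * s) * (k * D s)"
        using nonneg s' by (auto simp: \<gamma>_def intro!: mult_right_mono mult_left_mono)
      ultimately show ?thesis by (simp add: algebra_simps)
    qed
    ultimately show "\<exists>y. (H has_real_derivative y) (at s) \<and> y \<le> 0" by blast
  qed
  moreover have "\<gamma> * E t \<le> exp (- c * t) * E t"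
    using nonneg t by (auto simp: \<gamma>_def intro!: mult_right_mono mult_left_mono)
  ultimately show ?thesis by (simp add: H_def \<gamma>_def algebra_simps)
qed

lemma exp_le_one_minus:
  fixes x :: real
  assumes "0 \<le> x" "x \<le> 1/2"
  shows "exp (- (2 * x)) \<le> 1 - x"
proof -
  have "0 \<le> x * (1 - 2 * x)" using assms by simp
  then have "1 / (1 - x) \<le> 1 + 2 * x"
    using assms by (simp add: field_simps)
  also have "\<dots> \<le> exp (2 * x)" by (rule exp_ge_add_one_self)
  finally show ?thesis using assms by (simp add: exp_minus field_simps)
qed

text \<open>
  The powers of \<open>\<theta> = 1 - c dt\<close> take the place of the integrating factor. The exponent \<open>2 c\<close> instead of
  \<open>c\<close> is the price of bounding them below by an exponential, which is possible as \<open>c dt \<le> 1/2\<close>.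
\<close>

lemma gronwall_discrete:
  fixes E D B :: "nat \<Rightarrow> real"
  assumes ineq: "\<And>j. j \<in> {1..m} \<Longrightarrow> E j - E (j - 1) + dt * (k * D j) \<le> dt * (c * E j + B j)"
    and nonneg: "\<And>j. E j \<ge> 0" "\<And>j. D j \<ge> 0" "\<And>j. B j \<ge> 0" "c \<ge> 0" "k \<ge> 0" "dt \<ge> 0"
    and dt: "real m * dt = T" "c * dt \<le> 1/2"
    and n: "n \<le> m"
  shows "exp (- (2 * c) * T) * (E n + k * (dt * (\<Sum>j=1..n. D j))) \<le> E 0 + dt * (\<Sum>j=1..n. B j)"
proof -
  define \<gamma> where "\<gamma> = exp (- (2 * c) * T)"
  define \<theta> where "\<theta> = 1 - c * dt"
  have \<theta>: "0 \<le> \<theta>" "\<theta> \<le> 1" using dt nonneg by (auto simp: \<theta>_def)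
  have \<gamma>_le: "\<gamma> \<le> \<theta> ^ j" if "j \<le> m" for j
  proof -
    have "\<gamma> = exp (- (2 * (c * dt))) ^ m"
      by (simp add: \<gamma>_def ac_simps flip: dt(1) exp_of_nat_mult)
    also have "\<dots> \<le> \<theta> ^ m"
      unfolding \<theta>_def using dt nonneg by (intro power_mono exp_le_one_minus) auto
    also have "\<dots> \<le> \<theta> ^ j" using \<theta> that by (intro power_decreasing) auto
    finally show ?thesis .
  qed
  have "\<theta> ^ n * E n + \<gamma> * (k * (dt * (\<Sum>j=1..n. D j))) \<le> E 0 + dt * (\<Sum>j=1..n. B j)"
    using n
  proof (induction n)
    case 0
    then show ?case by simp
  next
    case (Suc n)
    have "\<theta> ^ n * (\<theta> * E (Suc n) + dt * (k * D (Suc n))) \<le> \<theta> ^ n * (E n + dt * B (Suc n))"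
      using ineq[of "Suc n"] Suc.prems \<theta>
      by (intro mult_left_mono) (auto simp: \<theta>_def algebra_simps)
    moreover have "\<theta> ^ n * (dt * B (Suc n)) \<le> dt * B (Suc n)"
      using \<theta> nonneg by (simp add: mult_left_le_one_le power_le_one)
    moreover have "\<gamma> * (dt * (k * D (Suc n))) \<le> \<theta> ^ n * (dt * (k * D (Suc n)))"
      using \<gamma>_le[of n] Suc.prems nonneg by (intro mult_right_mono) auto
    ultimately show ?case using Suc by (simp add: algebra_simps)
  qed
  moreover have "\<gamma> * E n \<le> \<theta> ^ n * E n"
    using \<gamma>_le[OF n] nonneg by (intro mult_right_mono) auto
  ultimately show ?thesis by (simp add: \<gamma>_def algebra_simps)
qed

text \<open>
  The exponent carries the factor 2 of the discrete estimate, so that both estimates share one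
  constant.
\<close>

lemma energy_estimate_continuous:
  fixes \<iota> :: "'v::real_inner \<Rightarrow> 'h::real_inner"
  assumes \<iota>: "bounded_linear \<iota>"
    and cont: "continuous_on {0..T} w" "continuous_on {0..T} g"
    and deriv: "\<And>t. t \<in> {0<..<T} \<Longrightarrow>
      ((\<lambda>s. (norm (\<iota> (w s)))\<^sup>2) has_real_derivative 2 * r t) (at t)"
    and bound: "\<And>t. t \<in> {0<..<T} \<Longrightarrow>
      r t \<le> - \<kappa> * (norm (w t))\<^sup>2 + g t * norm (w t) + L * norm (w t) * norm (\<iota> (w t))"
    and \<kappa>: "\<kappa> > 0"
    and t: "t \<in> {0..T}"
  shows "exp (- (2 * (L\<^sup>2 / \<kappa>)) * T) *
      ((norm (\<iota> (w t)))\<^sup>2 + \<kappa> / 2 * integral {0..t} (\<lambda>s. (norm (w s))\<^sup>2))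
    \<le> (norm (\<iota> (w 0)))\<^sup>2 + integral {0..t} (\<lambda>s. 2 / \<kappa> * (g s)\<^sup>2)"
proof -
  have c: "continuous_on {0..T} (\<lambda>s. \<iota> (w s))"
    using \<iota> cont(1) by (simp add: bounded_linear.continuous_on)
  have "exp (- (L\<^sup>2 / \<kappa>) * T) *
      ((norm (\<iota> (w t)))\<^sup>2 + \<kappa> / 2 * integral {0..t} (\<lambda>s. (norm (w s))\<^sup>2))
    \<le> (norm (\<iota> (w 0)))\<^sup>2 + integral {0..t} (\<lambda>s. 2 / \<kappa> * (g s)\<^sup>2)"
    by (rule gronwall_continuous[where E' = "\<lambda>t. 2 * r t"])
       (use \<kappa> t young_energy[OF \<kappa> bound] in
          \<open>auto intro!: continuous_intros c cont deriv simp del: times_divide_eq_left\<close>)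
  moreover have "exp (- (2 * (L\<^sup>2 / \<kappa>)) * T) \<le> exp (- (L\<^sup>2 / \<kappa>) * T)"
    using \<kappa> t by (simp add: divide_right_mono)
  moreover have "0 \<le> integral {0..t} (\<lambda>s. (norm (w s))\<^sup>2)"
    by (rule Henstock_Kurzweil_Integration.integral_nonneg)
       (use t in \<open>auto intro!: integrable_continuous_interval continuous_intros continuous_on_subset[OF cont(1)]\<close>)
  ultimately show ?thesis
    using \<kappa> by (meson add_nonneg_nonneg divide_nonneg_pos less_eq_real_def mult_nonneg_nonneg
        mult_right_mono order_trans zero_le_power2 zero_less_numeral)
qed

text \<open>
  Backward differences satisfy \<open>|x|\<^sup>2 - |y|\<^sup>2 \<le> 2 \<langle>x - y, x\<rangle>\<close>, which replaces the derivative of the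
  squared norm.
\<close>

lemma energy_estimate_discrete:
  fixes \<iota> :: "'v::real_inner \<Rightarrow> 'h::real_inner"
  assumes \<iota>: "linear \<iota>"
    and step: "\<And>j. j \<in> {1..m} \<Longrightarrow>
      inner (\<iota> (w j - w (j - 1))) (\<iota> (w j)) = dt * r j"
    and bound: "\<And>j. j \<in> {1..m} \<Longrightarrow>
      r j \<le> - \<kappa> * (norm (w j))\<^sup>2 + g j * norm (w j) + L * norm (w j) * norm (\<iota> (w j))"
    and \<kappa>: "\<kappa> > 0"
    and dt: "dt \<ge> 0" "real m * dt = T" "L\<^sup>2 / \<kappa> * dt \<le> 1/2"
    and n: "n \<le> m"
  shows "exp (- (2 * (L\<^sup>2 / \<kappa>)) * T) *
      ((norm (\<iota> (w n)))\<^sup>2 + \<kappa> / 2 * (dt * (\<Sum>j=1..n. (norm (w j))\<^sup>2)))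
    \<le> (norm (\<iota> (w 0)))\<^sup>2 + dt * (\<Sum>j=1..n. 2 / \<kappa> * (g j)\<^sup>2)"
proof (rule gronwall_discrete[OF _ _ _ _ _ _ dt(1,2,3) n])
  fix j assume j: "j \<in> {1..m}"
  have "0 \<le> (norm (\<iota> (w j) - \<iota> (w (j - 1))))\<^sup>2" by simp
  then have "(norm (\<iota> (w j)))\<^sup>2 - (norm (\<iota> (w (j - 1))))\<^sup>2
      \<le> 2 * inner (\<iota> (w j - w (j - 1))) (\<iota> (w j))"
    by (simp add: linear_diff[OF \<iota>] power2_norm_eq_inner inner_diff_left inner_diff_right inner_commute)
  also have "\<dots> = dt * (2 * r j)" using step[OF j] by simp
  also have "\<dots> \<le> dt * (L\<^sup>2 / \<kappa> * (norm (\<iota> (w j)))\<^sup>2 + 2 / \<kappa> * (g j)\<^sup>2 - \<kappa> / 2 * (norm (w j))\<^sup>2)"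
    using young_energy[OF \<kappa> bound[OF j]] dt(1) by (intro mult_left_mono) auto
  finally show "(norm (\<iota> (w j)))\<^sup>2 - (norm (\<iota> (w (j - 1))))\<^sup>2 + dt * (\<kappa> / 2 * (norm (w j))\<^sup>2)
      \<le> dt * (L\<^sup>2 / \<kappa> * (norm (\<iota> (w j)))\<^sup>2 + 2 / \<kappa> * (g j)\<^sup>2)"
    by (simp add: algebra_simps)
qed (use \<kappa> in auto)

section \<open>Bounds on the tested residual\<close>

text \<open>
  Splitting off \<open>G 0\<close> moves the inhomogeneous part of the nonlinearity into the data.
\<close>

lemma residual_self_bound:
  assumes coercive: "A x x \<ge> \<kappa> * (norm x)\<^sup>2"
    and lipschitz: "norm (G x - G 0) \<le> L * norm x"
    and data: "norm h + norm (G 0) \<le> M"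
    and embed: "norm (\<iota> x) \<le> e * norm x"
  shows "residual \<iota> A G h x x \<le> - \<kappa> * (norm x)\<^sup>2 + (e * M) * norm x + L * norm x * norm (\<iota> x)"
proof -
  have "inner h (\<iota> x) - inner (G x) (\<iota> x) = inner (h - G 0) (\<iota> x) + inner (G 0 - G x) (\<iota> x)"
    by (simp add: inner_diff_left)
  also have "inner (h - G 0) (\<iota> x) \<le> norm (h - G 0) * norm (\<iota> x)" by (rule norm_cauchy_schwarz)
  also have "norm (h - G 0) * norm (\<iota> x) \<le> M * (e * norm x)"
    using data embed norm_triangle_ineq4[of h "G 0"] norm_ge_zero[of h] norm_ge_zero[of "G 0"]
    by (intro mult_mono norm_ge_zero) linarith+
  also have "inner (G 0 - G x) (\<iota> x) \<le> norm (G 0 - G x) * norm (\<iota> x)" by (rule norm_cauchy_schwarz)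
  also have "norm (G 0 - G x) * norm (\<iota> x) \<le> L * norm x * norm (\<iota> x)"
    using lipschitz by (intro mult_right_mono) (auto simp: norm_minus_commute)
  finally show ?thesis using coercive by (simp add: residual_def algebra_simps)
qed

text \<open>
  The coercivity is that of \<open>A1\<close>, the Lipschitz bound that of \<open>G1\<close>, and the change from \<open>A0\<close>, \<open>G0\<close> to
  \<open>A1\<close>, \<open>G1\<close> is evaluated at \<open>x0\<close>. Hence the defect involves \<open>norm x0\<close> but not \<open>norm x1\<close>.
\<close>

lemma residual_diff_bound:
  fixes \<iota> :: "'v::real_inner \<Rightarrow> 'h::real_inner"
  assumes bil: "bilinear A1"
    and coercive: "A1 (x1 - x0) (x1 - x0) \<ge> \<kappa> * (norm (x1 - x0))\<^sup>2"
    and lipschitz: "norm (G1 x1 - G1 x0) \<le> L * norm (x1 - x0)"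
    and form: "\<bar>A1 x0 (x1 - x0) - A0 x0 (x1 - x0)\<bar> \<le> \<omega>a * norm x0 * norm (x1 - x0)"
    and nonlin: "norm (G1 x0 - G0 x0) \<le> \<omega>F * (norm x0 + 1)"
    and embed: "norm (\<iota> (x1 - x0)) \<le> e * norm (x1 - x0)"
    and nonneg: "\<omega>a \<ge> 0" "\<omega>F \<ge> 0" "e \<ge> 0"
  shows "residual \<iota> A1 G1 h x1 (x1 - x0) - residual \<iota> A0 G0 h x0 (x1 - x0)
    \<le> - \<kappa> * (norm (x1 - x0))\<^sup>2 + ((\<omega>a + \<omega>F) * (1 + e) * (norm x0 + 1)) * norm (x1 - x0)
      + L * norm (x1 - x0) * norm (\<iota> (x1 - x0))"
proof -
  define d where "d = x1 - x0"
  have "A1 x1 d = A1 d d + A1 x0 d"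
    using bilinear_ladd[OF bil, of d x0 d] by (simp add: d_def)
  then have "residual \<iota> A1 G1 h x1 d - residual \<iota> A0 G0 h x0 d
      = - A1 d d - (A1 x0 d - A0 x0 d) + inner (G1 x0 - G1 x1) (\<iota> d) + inner (G0 x0 - G1 x0) (\<iota> d)"
    by (simp add: residual_def inner_diff_left)
  moreover have "- (A1 x0 d - A0 x0 d) \<le> \<omega>a * norm x0 * norm d"
    using form by (simp add: d_def)
  moreover have "inner (G1 x0 - G1 x1) (\<iota> d) \<le> L * norm d * norm (\<iota> d)"
    by (rule order_trans[OF norm_cauchy_schwarz mult_right_mono])
       (use lipschitz in \<open>auto simp: norm_minus_commute d_def\<close>)
  moreover have "inner (G0 x0 - G1 x0) (\<iota> d) \<le> (\<omega>F * (norm x0 + 1)) * (e * norm d)"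
  proof -
    have "inner (G0 x0 - G1 x0) (\<iota> d) \<le> norm (G0 x0 - G1 x0) * norm (\<iota> d)" by (rule norm_cauchy_schwarz)
    also have "\<dots> \<le> (\<omega>F * (norm x0 + 1)) * (e * norm d)"
      using nonlin embed nonneg by (intro mult_mono) (auto simp: norm_minus_commute d_def)
    finally show ?thesis .
  qed
  moreover have "\<omega>a * norm x0 * norm d + (\<omega>F * (norm x0 + 1)) * (e * norm d)
      \<le> ((\<omega>a + \<omega>F) * (1 + e) * (norm x0 + 1)) * norm d"
  proof -
    have "\<omega>a * norm x0 + \<omega>F * (norm x0 + 1) * e \<le> (\<omega>a + \<omega>F) * (1 + e) * (norm x0 + 1)"
      using nonneg by (simp add: algebra_simps)
    from mult_right_mono[OF this norm_ge_zero[of d]] show ?thesis by (simp add: algebra_simps)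
  qed
  ultimately show ?thesis using coercive unfolding d_def[symmetric] by linarith
qed

lemma modulus_nonneg: "modulus_of_continuity \<omega> \<Longrightarrow> 0 \<le> r \<Longrightarrow> 0 \<le> \<omega> r"
  by (simp add: modulus_of_continuity_def)

text \<open>
  No value can differ from the one at a fixed parameter by more than the modulus at the diameter of
  the parameter set.
\<close>

lemma ex_uniform_norm_bound:
  fixes F0 :: "real \<Rightarrow> 'h::real_normed_vector"
  assumes "compact P" "modulus_of_continuity \<omega>"
    and "\<And>\<mu> \<nu>. \<mu> \<in> P \<Longrightarrow> \<nu> \<in> P \<Longrightarrow> norm (F0 \<mu> - F0 \<nu>) \<le> \<omega> \<bar>\<mu> - \<nu>\<bar>"
  obtains M where "\<And>\<mu>. \<mu> \<in> P \<Longrightarrow> norm (F0 \<mu>) \<le> M"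
proof (cases "P = {}")
  case False
  then obtain \<nu> where \<nu>: "\<nu> \<in> P" by blast
  have "norm (F0 \<mu>) \<le> norm (F0 \<nu>) + \<omega> (diameter P)" if "\<mu> \<in> P" for \<mu>
  proof -
    have "\<bar>\<mu> - \<nu>\<bar> \<le> diameter P"
      using diameter_bounded_bound[OF compact_imp_bounded[OF assms(1)] that \<nu>]
      by (simp add: dist_real_def)
    then have "\<omega> \<bar>\<mu> - \<nu>\<bar> \<le> \<omega> (diameter P)"
      using assms(2) by (auto simp: modulus_of_continuity_def intro: mono_onD)
    then show ?thesis
      using assms(3)[OF that \<nu>] norm_triangle_sub[of "F0 \<mu>" "F0 \<nu>"] by linarith
  qed
  then show thesis using that by blast
qed (use that in blast)

text \<open>
  Minkowski's inequality: the mean error is an \<open>L2_set\<close> norm with weights \<open>1/m\<close>, for which the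
  constant function \<open>c\<close> has norm \<open>c\<close>.
\<close>

lemma mean_error_le_add:
  assumes "m \<ge> 1" "0 \<le> c"
    and "\<And>k. k \<in> {1..m} \<Longrightarrow>
      norm (\<iota> (u (tgrid T m k)) - \<iota> (U k)) \<le> norm (\<iota> (u' (tgrid T m k)) - \<iota> (U' k)) + c"
  shows "mean_error \<iota> T m u U \<le> mean_error \<iota> T m u' U' + c"
proof -
  have as_L2: "mean_error \<iota> T m u U
      = L2_set (\<lambda>k. norm (\<iota> (u (tgrid T m k)) - \<iota> (U k))) {1..m} / sqrt (real m)" for u U
    by (simp add: mean_error_def L2_set_def real_sqrt_divide)
  have "L2_set (\<lambda>k. norm (\<iota> (u (tgrid T m k)) - \<iota> (U k))) {1..m}
      \<le> L2_set (\<lambda>k. norm (\<iota> (u' (tgrid T m k)) - \<iota> (U' k)) + c) {1..m}"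
    by (rule L2_set_mono) (use assms(3) in auto)
  also have "\<dots> \<le> L2_set (\<lambda>k. norm (\<iota> (u' (tgrid T m k)) - \<iota> (U' k))) {1..m} + L2_set (\<lambda>k. c) {1..m}"
    by (rule L2_set_triangle_ineq)
  also have "L2_set (\<lambda>k. c) {1..m} = sqrt (real m) * c"
    using assms(2) by (simp add: L2_set_constant)
  finally show ?thesis
    using assms(1) unfolding as_L2 by (simp add: field_simps)
qed

lemma tgrid_mem: "0 \<le> T \<Longrightarrow> 1 \<le> m \<Longrightarrow> k \<le> m \<Longrightarrow> tgrid T m k \<in> {0..T}"
  by (auto simp: tgrid_def field_simps mult_left_mono)

lemma reduced_solution_step:
  assumes U: "reduced_solution \<iota> T m A G f \<phi> Vl U" and \<iota>: "linear \<iota>"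
    and "T > 0" "m \<ge> 1" "k \<in> {1..m}" "\<psi> \<in> Vl"
  shows "inner (\<iota> (U k - U (k - 1))) (\<iota> \<psi>) = T / real m * residual \<iota> A G (f (tgrid T m k)) (U k) \<psi>"
proof -
  have "inner (\<iota> (backward_diff T m U k)) (\<iota> \<psi>) = residual \<iota> A G (f (tgrid T m k)) (U k) \<psi>"
    using assms unfolding reduced_solution_def residual_def by force
  moreover have "\<iota> (backward_diff T m U k) = \<iota> (U k - U (k - 1)) /\<^sub>R (T / real m)"
    by (simp add: backward_diff_def linear_scale[OF \<iota>])
  ultimately show ?thesis using assms(3,4) by (simp add: field_simps)
qed

section \<open>Stability in the parameter\<close>

text \<open>
  The parametric problem with coercivity constant \<open>\<kappa>\<close>, Lipschitz constant \<open>L\<close> and data bound \<open>M\<close> that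
  hold for all parameters at once. Every constant obtained below is an expression in these numbers,
  \<open>e\<close>, \<open>T\<close> and \<open>norm (\<iota> \<phi>)\<close>, which is how independence of the
  parameters, of the number of time steps and of the reduced space becomes visible.
\<close>

locale parametric_problem =
  fixes \<iota> :: "'v::{real_inner, banach, second_countable_topology} \<Rightarrow>
              'h::{real_inner, banach, second_countable_topology}"
    and T :: real and P :: "real set" and f :: "real \<Rightarrow> 'h" and \<phi> :: 'v
    and a :: "'v \<Rightarrow> 'v \<Rightarrow> real \<Rightarrow> real" and F :: "'v \<Rightarrow> real \<Rightarrow> 'h"
    and \<beta> :: "real \<Rightarrow> real" and \<kappa> L e M :: real and \<omega>_a \<omega>_F :: "real \<Rightarrow> real" and u :: "real \<Rightarrow> real \<Rightarrow> 'v"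
  assumes bounded_linear_embed: "bounded_linear \<iota>" and inj_embed: "inj \<iota>"
    and embed_le: "norm (\<iota> x) \<le> e * norm x" and e_nonneg: "e \<ge> 0"
    and T_pos: "T > 0" and f_cont: "continuous_on {0..T} f"
    and a_bilinear: "\<mu> \<in> P \<Longrightarrow> bilinear (\<lambda>x y. a x y \<mu>)"
    and a_bounded: "\<mu> \<in> P \<Longrightarrow> \<bar>a x y \<mu>\<bar> \<le> \<beta> \<mu> * norm x * norm y"
    and coercive: "\<mu> \<in> P \<Longrightarrow> a x x \<mu> \<ge> \<kappa> * (norm x)\<^sup>2" and \<kappa>_pos: "\<kappa> > 0"
    and lipschitz: "\<mu> \<in> P \<Longrightarrow> norm (F x \<mu> - F y \<mu>) \<le> L * norm (x - y)"
    and data: "\<mu> \<in> P \<Longrightarrow> t \<in> {0..T} \<Longrightarrow> norm (f t) + norm (F 0 \<mu>) \<le> M"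
    and moduli: "modulus_of_continuity \<omega>_a" "modulus_of_continuity \<omega>_F"
    and form_modulus: "\<mu> \<in> P \<Longrightarrow> \<nu> \<in> P \<Longrightarrow>
               \<bar>a x y \<mu> - a x y \<nu>\<bar> \<le> \<omega>_a \<bar>\<mu> - \<nu>\<bar> * norm x * norm y"
    and nonlin_modulus: "\<mu> \<in> P \<Longrightarrow> \<nu> \<in> P \<Longrightarrow>
               norm (F x \<mu> - F x \<nu>) \<le> \<omega>_F \<bar>\<mu> - \<nu>\<bar> * (norm x + 1)"
    and solution: "\<mu> \<in> P \<Longrightarrow>
               solves \<iota> T (\<lambda>x y. a x y \<mu>) (\<lambda>x. F x \<mu>) f \<phi> (\<lambda>t. \<iota> (u \<mu> t))"
    and u_cont: "\<mu> \<in> P \<Longrightarrow> continuous_on {0..T} (u \<mu>)"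
begin

lemma linear_embed: "linear \<iota>"
  using bounded_linear_embed by (rule bounded_linear.linear)

lemma embed_diff: "\<iota> (x - y) = \<iota> x - \<iota> y"
  by (rule linear_diff[OF linear_embed])

abbreviation res :: "real \<Rightarrow> 'h \<Rightarrow> 'v \<Rightarrow> 'v \<Rightarrow> real" where
  "res \<mu> \<equiv> residual \<iota> (\<lambda>x y. a x y \<mu>) (\<lambda>x. F x \<mu>)"

abbreviation \<rho> :: "real \<Rightarrow> real" where "\<rho> s \<equiv> \<omega>_a s + \<omega>_F s"

text \<open>
  The factor lost in either energy estimate.
\<close>

definition "\<gamma> = exp (- (2 * (L\<^sup>2 / \<kappa>)) * T)"

text \<open>
  The a priori bound for the squared \<open>L\<^sup>2(0,T;V)\<close> norm of a solution, exact or reduced.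
\<close>

definition "state_bound = ((norm (\<iota> \<phi>))\<^sup>2 + T * (2 / \<kappa> * (e * M)\<^sup>2)) / (\<gamma> * (\<kappa> / 2))"

text \<open>
  The factor \<open>2 * state_bound + 2 * T\<close> bounds the integral over time of \<open>(norm (u t) + 1)\<^sup>2\<close>.
\<close>

definition "stability_constant = sqrt (2 / \<kappa> * (1 + e)\<^sup>2 * (2 * state_bound + 2 * T) / \<gamma>)"

lemma \<gamma>_pos: "\<gamma> > 0"
  by (simp add: \<gamma>_def)

lemma a_bounded_bilinear:
  assumes "\<mu> \<in> P"
  shows "bounded_bilinear (\<lambda>x y. a x y \<mu>)"
proof
  note bil = a_bilinear[OF assms]
  show "a (x + x') y \<mu> = a x y \<mu> + a x' y \<mu>" for x x' y by (rule bilinear_ladd[OF bil])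
  show "a x (y + y') \<mu> = a x y \<mu> + a x y' \<mu>" for x y y' by (rule bilinear_radd[OF bil])
  show "a (r *\<^sub>R x) y \<mu> = r *\<^sub>R a x y \<mu>" for r x y by (rule bilinear_lmul[OF bil])
  show "a x (r *\<^sub>R y) \<mu> = r *\<^sub>R a x y \<mu>" for r x y by (rule bilinear_rmul[OF bil])
  show "\<exists>K. \<forall>x y. norm (a x y \<mu>) \<le> norm x * norm y * K"
    using a_bounded[OF assms] by (intro exI[of _ "\<beta> \<mu>"]) (simp add: ac_simps)
qed

lemma F_cont: "\<mu> \<in> P \<Longrightarrow> continuous_on UNIV (\<lambda>x. F x \<mu>)"
proof -
  assume "\<mu> \<in> P"
  then have "\<bar>L\<bar>-lipschitz_on UNIV (\<lambda>x. F x \<mu>)"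
    using lipschitz by (intro lipschitz_onI)
      (auto simp: dist_norm intro!: order_trans[OF lipschitz] mult_right_mono)
  then show ?thesis by (rule lipschitz_on_continuous_on)
qed

text \<open>
  The joint continuity of the residual in time and test vector that \<open>energy_DERIV\<close> asks for.
\<close>

lemma residual_tendsto:
  assumes \<mu>: "\<mu> \<in> P" and t: "t \<in> {0<..<T}" and z: "(z \<longlongrightarrow> t) \<F>" and v: "(v \<longlongrightarrow> v0) \<F>"
  shows "((\<lambda>s. res \<mu> (f (z s)) (u \<mu> (z s)) (v s)) \<longlongrightarrow> res \<mu> (f t) (u \<mu> t) v0) \<F>"
proof -
  have "isCont f t" "isCont (u \<mu>) t"
    using t f_cont u_cont[OF \<mu>] by (metis at_within_Icc_at continuous_on_eq_continuous_within
        greaterThanLessThan_iff greaterThanLessThan_subseteq_atLeastAtMost_iff order_refl subsetD)+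
  then have f: "((\<lambda>s. f (z s)) \<longlongrightarrow> f t) \<F>" and u: "((\<lambda>s. u \<mu> (z s)) \<longlongrightarrow> u \<mu> t) \<F>"
    using z by (auto intro: isCont_tendsto_compose)
  have "isCont (\<lambda>x. F x \<mu>) (u \<mu> t)"
    using F_cont[OF \<mu>] by (simp add: continuous_on_eq_continuous_at)
  then have F: "((\<lambda>s. F (u \<mu> (z s)) \<mu>) \<longlongrightarrow> F (u \<mu> t) \<mu>) \<F>"
    using u by (rule isCont_tendsto_compose)
  show ?thesis
    unfolding residual_def
    by (intro tendsto_intros f F bounded_linear.tendsto[OF bounded_linear_embed] v
        bounded_bilinear.tendsto[OF a_bounded_bilinear[OF \<mu>] u v])
qed

lemma weak_equation:
  assumes "\<mu> \<in> P" "t \<in> {0<..<T}"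
  shows "((\<lambda>s. inner (\<iota> (u \<mu> s)) (\<iota> \<psi>)) has_real_derivative res \<mu> (f t) (u \<mu> t) \<psi>) (at t)"
  by (rule solves_DERIV[OF bounded_linear_embed inj_embed solution[OF assms(1)]
        u_cont[OF assms(1)] f_cont a_bounded_bilinear[OF assms(1)] F_cont[OF assms(1)] assms(2)])

lemma initial_value: "\<mu> \<in> P \<Longrightarrow> \<iota> (u \<mu> 0) = \<iota> \<phi>"
  using solution by (simp add: solves_def)

lemma self_bound:
  assumes "\<mu> \<in> P" "t \<in> {0..T}"
  shows "res \<mu> (f t) x x \<le> - \<kappa> * (norm x)\<^sup>2 + (e * M) * norm x + L * norm x * norm (\<iota> x)"
  by (rule residual_self_bound)
     (use assms lipschitz[of \<mu> x 0] in \<open>simp_all add: coercive data embed_le\<close>)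

lemma diff_bound:
  assumes "\<mu>0 \<in> P" "\<mu>1 \<in> P"
  shows "res \<mu>1 h x1 (x1 - x0) - res \<mu>0 h x0 (x1 - x0)
    \<le> - \<kappa> * (norm (x1 - x0))\<^sup>2 + (\<rho> \<bar>\<mu>1 - \<mu>0\<bar> * (1 + e) * (norm x0 + 1)) * norm (x1 - x0)
      + L * norm (x1 - x0) * norm (\<iota> (x1 - x0))"
  by (rule residual_diff_bound)
     (rule a_bilinear coercive lipschitz form_modulus nonlin_modulus embed_le e_nonneg
        modulus_nonneg[OF moduli(1)] modulus_nonneg[OF moduli(2)] abs_ge_zero assms)+

text \<open>
  The energy estimate for a single solution, whose data term is the constant \<open>e * M\<close>.
\<close>

lemma state_bound_continuous:
  assumes "\<mu> \<in> P" "t \<in> {0..T}"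
  shows "integral {0..t} (\<lambda>s. (norm (u \<mu> s))\<^sup>2) \<le> state_bound"
proof -
  have deriv: "((\<lambda>s. (norm (\<iota> (u \<mu> s)))\<^sup>2) has_real_derivative 2 * res \<mu> (f t) (u \<mu> t) (u \<mu> t)) (at t)"
    if "t \<in> {0<..<T}" for t
    by (rule energy_DERIV[OF linear_embed u_cont[OF assms(1)] weak_equation[OF assms(1)] that])
       (auto intro: residual_tendsto assms(1) that)
  have "\<gamma> * ((norm (\<iota> (u \<mu> t)))\<^sup>2 + \<kappa> / 2 * integral {0..t} (\<lambda>s. (norm (u \<mu> s))\<^sup>2))
    \<le> (norm (\<iota> (u \<mu> 0)))\<^sup>2 + integral {0..t} (\<lambda>s. 2 / \<kappa> * (e * M)\<^sup>2)"
    unfolding \<gamma>_def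
  proof (rule energy_estimate_continuous[OF bounded_linear_embed u_cont[OF assms(1)] _ deriv])
    fix s assume "s \<in> {0<..<T}"
    then show "res \<mu> (f s) (u \<mu> s) (u \<mu> s)
        \<le> - \<kappa> * (norm (u \<mu> s))\<^sup>2 + e * M * norm (u \<mu> s) + L * norm (u \<mu> s) * norm (\<iota> (u \<mu> s))"
      by (intro self_bound assms(1)) auto
  qed (use assms \<kappa>_pos in auto)
  moreover have "integral {0..t} (\<lambda>s. 2 / \<kappa> * (e * M)\<^sup>2) \<le> T * (2 / \<kappa> * (e * M)\<^sup>2)"
    using assms(2) \<kappa>_pos by (auto intro!: mult_right_mono divide_right_mono)
  moreover have "0 \<le> \<gamma> * (norm (\<iota> (u \<mu> t)))\<^sup>2" using \<gamma>_pos by simp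
  ultimately have "\<gamma> * (\<kappa> / 2) * integral {0..t} (\<lambda>s. (norm (u \<mu> s))\<^sup>2)
      \<le> (norm (\<iota> \<phi>))\<^sup>2 + T * (2 / \<kappa> * (e * M)\<^sup>2)"
    unfolding initial_value[OF assms(1)] distrib_left mult.assoc by linarith
  then show ?thesis
    using \<gamma>_pos \<kappa>_pos by (simp add: state_bound_def pos_le_divide_eq mult.commute)
qed

lemma data_bound_square:
  fixes r x :: real
  shows "2 / \<kappa> * (r * (1 + e) * (x + 1))\<^sup>2 \<le> 2 / \<kappa> * (1 + e)\<^sup>2 * r\<^sup>2 * (2 * x\<^sup>2 + 2)"
proof -
  have "(x + 1)\<^sup>2 \<le> 2 * x\<^sup>2 + 2"
    using sum_squares_bound[of x 1] by (simp add: power2_sum)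
  from mult_left_mono[OF this, of "2 / \<kappa> * (1 + e)\<^sup>2 * r\<^sup>2"] show ?thesis
    using \<kappa>_pos by (simp add: power_mult_distrib ac_simps)
qed

lemma le_stability_constant:
  assumes "\<gamma> * x\<^sup>2 \<le> 2 / \<kappa> * (1 + e)\<^sup>2 * r\<^sup>2 * (2 * state_bound + 2 * T)" "r \<ge> 0"
  shows "x \<le> stability_constant * r"
proof -
  define K where "K = 2 / \<kappa> * (1 + e)\<^sup>2 * (2 * state_bound + 2 * T)"
  have "\<gamma> * x\<^sup>2 \<le> K * r\<^sup>2" using assms(1) by (simp add: K_def ac_simps)
  then have "x\<^sup>2 \<le> K / \<gamma> * r\<^sup>2" using \<gamma>_pos by (simp add: field_simps)
  then have "\<bar>x\<bar> \<le> sqrt (K / \<gamma> * r\<^sup>2)"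
    by (metis real_sqrt_abs real_sqrt_le_mono)
  also have "\<dots> = stability_constant * r"
    using assms(2) by (simp only: stability_constant_def K_def real_sqrt_mult real_sqrt_abs abs_of_nonneg)
  finally show ?thesis by linarith
qed

text \<open>
  The difference of the two solutions starts from zero, so its energy is bounded by the defect alone,
  which is a multiple of the modulus times \<open>norm (u \<mu>0 t) + 1\<close>.
\<close>

lemma parameter_stability_continuous:
  assumes \<mu>: "\<mu>0 \<in> P" "\<mu>1 \<in> P" and t: "t \<in> {0..T}"
  shows "norm (\<iota> (u \<mu>1 t - u \<mu>0 t)) \<le> stability_constant * \<rho> \<bar>\<mu>1 - \<mu>0\<bar>"
proof (rule le_stability_constant)
  define r where "r = \<rho> \<bar>\<mu>1 - \<mu>0\<bar>"
  show "\<rho> \<bar>\<mu>1 - \<mu>0\<bar> \<ge> 0" using moduli by (simp add: modulus_nonneg)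
  define w where "w s = u \<mu>1 s - u \<mu>0 s" for s
  define R where "R s \<psi> = res \<mu>1 (f s) (u \<mu>1 s) \<psi> - res \<mu>0 (f s) (u \<mu>0 s) \<psi>" for s \<psi>
  have cw: "continuous_on {0..T} w"
    unfolding w_def by (intro continuous_intros u_cont \<mu>)
  have deriv: "((\<lambda>s. (norm (\<iota> (w s)))\<^sup>2) has_real_derivative 2 * R t (w t)) (at t)"
    if t: "t \<in> {0<..<T}" for t
  proof (rule energy_DERIV[OF linear_embed cw _ t])
    show "((\<lambda>s. inner (\<iota> (w s)) (\<iota> \<psi>)) has_real_derivative R t \<psi>) (at t)"
      if "t \<in> {0<..<T}" for t \<psi>
      unfolding w_def R_def embed_diff inner_diff_left
      by (intro DERIV_diff weak_equation \<mu> that)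
  qed (auto simp: R_def intro!: tendsto_diff residual_tendsto \<mu> t)
  have "\<gamma> * ((norm (\<iota> (w t)))\<^sup>2 + \<kappa> / 2 * integral {0..t} (\<lambda>s. (norm (w s))\<^sup>2))
    \<le> (norm (\<iota> (w 0)))\<^sup>2 + integral {0..t} (\<lambda>s. 2 / \<kappa> * (r * (1 + e) * (norm (u \<mu>0 s) + 1))\<^sup>2)"
    unfolding \<gamma>_def
  proof (rule energy_estimate_continuous[OF bounded_linear_embed cw _ deriv])
    fix t assume "t \<in> {0<..<T}"
    show "R t (w t) \<le> - \<kappa> * (norm (w t))\<^sup>2 + r * (1 + e) * (norm (u \<mu>0 t) + 1) * norm (w t)
        + L * norm (w t) * norm (\<iota> (w t))"
      unfolding R_def w_def r_def by (rule diff_bound[OF \<mu>])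
  next
    show "continuous_on {0..T} (\<lambda>s. r * (1 + e) * (norm (u \<mu>0 s) + 1))"
      by (intro continuous_intros u_cont \<mu>)
  qed (use t \<kappa>_pos in auto)
  moreover have "\<iota> (w 0) = 0"
    by (simp add: w_def embed_diff initial_value \<mu>)
  moreover have "0 \<le> \<kappa> / 2 * integral {0..t} (\<lambda>s. (norm (w s))\<^sup>2)"
    using \<kappa>_pos t
    by (intro mult_nonneg_nonneg Henstock_Kurzweil_Integration.integral_nonneg
        integrable_continuous_interval continuous_intros continuous_on_subset[OF cw]) auto
  then have "\<gamma> * (norm (\<iota> (w t)))\<^sup>2
      \<le> \<gamma> * ((norm (\<iota> (w t)))\<^sup>2 + \<kappa> / 2 * integral {0..t} (\<lambda>s. (norm (w s))\<^sup>2))"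
    using \<gamma>_pos by simp
  ultimately have "\<gamma> * (norm (\<iota> (w t)))\<^sup>2
      \<le> integral {0..t} (\<lambda>s. 2 / \<kappa> * (r * (1 + e) * (norm (u \<mu>0 s) + 1))\<^sup>2)" by simp
  also have "\<dots> \<le> integral {0..t} (\<lambda>s. 2 / \<kappa> * (1 + e)\<^sup>2 * r\<^sup>2 * (2 * (norm (u \<mu>0 s))\<^sup>2 + 2))"
    using t
    by (intro integral_le integrable_continuous_interval continuous_intros data_bound_square
        continuous_on_subset[OF u_cont[OF \<mu>(1)]]) auto
  also have "\<dots> = 2 / \<kappa> * (1 + e)\<^sup>2 * r\<^sup>2 * (2 * integral {0..t} (\<lambda>s. (norm (u \<mu>0 s))\<^sup>2) + 2 * t)"
  proof -
    have "(\<lambda>s. 2 * (norm (u \<mu>0 s))\<^sup>2) integrable_on {0..t}"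
      using t by (intro integrable_continuous_interval continuous_intros
          continuous_on_subset[OF u_cont[OF \<mu>(1)]]) auto
    then have "integral {0..t} (\<lambda>s. 2 * (norm (u \<mu>0 s))\<^sup>2 + 2)
        = 2 * integral {0..t} (\<lambda>s. (norm (u \<mu>0 s))\<^sup>2) + 2 * t"
      using t by (subst Henstock_Kurzweil_Integration.integral_add) auto
    then show ?thesis by (simp only: Henstock_Kurzweil_Integration.integral_mult_right)
  qed
  also have "\<dots> \<le> 2 / \<kappa> * (1 + e)\<^sup>2 * r\<^sup>2 * (2 * state_bound + 2 * T)"
    using state_bound_continuous[OF \<mu>(1) t] t \<kappa>_pos
    by (intro mult_left_mono add_mono) auto
  finally show "\<gamma> * (norm (\<iota> (u \<mu>1 t - u \<mu>0 t)))\<^sup>2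
      \<le> 2 / \<kappa> * (1 + e)\<^sup>2 * (\<rho> \<bar>\<mu>1 - \<mu>0\<bar>)\<^sup>2 * (2 * state_bound + 2 * T)"
    by (simp only: w_def r_def)
qed

text \<open>
  The discrete initial value is the H-projection of \<open>\<phi>\<close> onto \<open>Vl\<close>, so its H-norm does not exceed that
  of \<open>\<phi>\<close> and the continuous bound carries over with the same constant.
\<close>

lemma state_bound_discrete:
  assumes \<mu>: "\<mu> \<in> P" and m: "m \<ge> 1" and dt: "L\<^sup>2 / \<kappa> * (T / real m) \<le> 1/2"
    and U: "reduced_solution \<iota> T m (\<lambda>x y. a x y \<mu>) (\<lambda>x. F x \<mu>) f \<phi> Vl U"
    and n: "n \<le> m"
  shows "T / real m * (\<Sum>j=1..n. (norm (U j))\<^sup>2) \<le> state_bound"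
proof -
  have UV: "U j \<in> Vl" if "j \<le> m" for j using U that by (auto simp: reduced_solution_def)
  have "\<gamma> * ((norm (\<iota> (U n)))\<^sup>2 + \<kappa> / 2 * (T / real m * (\<Sum>j=1..n. (norm (U j))\<^sup>2)))
    \<le> (norm (\<iota> (U 0)))\<^sup>2 + T / real m * (\<Sum>j=1..n. 2 / \<kappa> * (e * M)\<^sup>2)"
    unfolding \<gamma>_def
  proof (rule energy_estimate_discrete[OF linear_embed _ _ \<kappa>_pos _ _ dt n])
    fix j assume j: "j \<in> {1..m}"
    then show "inner (\<iota> (U j - U (j - 1))) (\<iota> (U j)) = T / real m * res \<mu> (f (tgrid T m j)) (U j) (U j)"
      by (intro reduced_solution_step[OF U linear_embed T_pos m]) (auto intro: UV)
    show "res \<mu> (f (tgrid T m j)) (U j) (U j)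
        \<le> - \<kappa> * (norm (U j))\<^sup>2 + (e * M) * norm (U j) + L * norm (U j) * norm (\<iota> (U j))"
      using j m T_pos by (intro self_bound \<mu> tgrid_mem) auto
  qed (use T_pos m in auto)
  moreover have "norm (\<iota> (U 0)) \<le> norm (\<iota> \<phi>)"
  proof -
    have "inner (\<iota> (U 0)) (\<iota> (U 0)) = inner (\<iota> \<phi>) (\<iota> (U 0))"
      using U UV[of 0] by (auto simp: reduced_solution_def)
    then have "norm (\<iota> (U 0)) * norm (\<iota> (U 0)) \<le> norm (\<iota> \<phi>) * norm (\<iota> (U 0))"
      using norm_cauchy_schwarz[of "\<iota> \<phi>" "\<iota> (U 0)"] by (simp flip: power2_norm_eq_inner power2_eq_square)
    then show ?thesis by (cases "norm (\<iota> (U 0)) = 0") auto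
  qed
  then have "(norm (\<iota> (U 0)))\<^sup>2 \<le> (norm (\<iota> \<phi>))\<^sup>2" by (rule power_mono) simp
  moreover have "T / real m * (\<Sum>j=1..n. 2 / \<kappa> * (e * M)\<^sup>2) \<le> T * (2 / \<kappa> * (e * M)\<^sup>2)"
  proof -
    have "T / real m * real n \<le> T" using n m T_pos by (simp add: field_simps)
    then have "T / real m * real n * (2 / \<kappa> * (e * M)\<^sup>2) \<le> T * (2 / \<kappa> * (e * M)\<^sup>2)"
      using \<kappa>_pos by (intro mult_right_mono) auto
    then show ?thesis by (simp add: ac_simps)
  qed
  moreover have "0 \<le> \<gamma> * (norm (\<iota> (U n)))\<^sup>2" using \<gamma>_pos by simp
  ultimately have "\<gamma> * (\<kappa> / 2) * (T / real m * (\<Sum>j=1..n. (norm (U j))\<^sup>2))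
      \<le> (norm (\<iota> \<phi>))\<^sup>2 + T * (2 / \<kappa> * (e * M)\<^sup>2)"
    unfolding distrib_left mult.assoc by linarith
  then show ?thesis
    using \<gamma>_pos \<kappa>_pos unfolding state_bound_def
    by (subst pos_le_divide_eq) (auto simp: mult.commute)
qed

text \<open>
  The two schemes share \<open>Vl\<close>: the difference of their solutions may be used as a test function, and
  it starts from zero because both initial values are the same projection.
\<close>

lemma parameter_stability_discrete:
  assumes \<mu>: "\<mu>0 \<in> P" "\<mu>1 \<in> P" and m: "m \<ge> 1" and dt: "L\<^sup>2 / \<kappa> * (T / real m) \<le> 1/2"
    and Vl: "subspace Vl"
    and U0: "reduced_solution \<iota> T m (\<lambda>x y. a x y \<mu>0) (\<lambda>x. F x \<mu>0) f \<phi> Vl U0"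
    and U1: "reduced_solution \<iota> T m (\<lambda>x y. a x y \<mu>1) (\<lambda>x. F x \<mu>1) f \<phi> Vl U1"
    and n: "n \<le> m"
  shows "norm (\<iota> (U1 n - U0 n)) \<le> stability_constant * \<rho> \<bar>\<mu>1 - \<mu>0\<bar>"
proof (rule le_stability_constant)
  define r where "r = \<rho> \<bar>\<mu>1 - \<mu>0\<bar>"
  show "\<rho> \<bar>\<mu>1 - \<mu>0\<bar> \<ge> 0" using moduli by (simp add: modulus_nonneg)
  define w where "w j = U1 j - U0 j" for j
  define \<Delta> where "\<Delta> = T / real m"
  have \<Delta>: "\<Delta> \<ge> 0" "real m * \<Delta> = T" using T_pos m by (auto simp: \<Delta>_def)
  have wV: "w j \<in> Vl" if "j \<le> m" for j
    using U0 U1 that subspace_diff[OF Vl] by (auto simp: reduced_solution_def w_def)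
  have "\<gamma> * ((norm (\<iota> (w n)))\<^sup>2 + \<kappa> / 2 * (\<Delta> * (\<Sum>j=1..n. (norm (w j))\<^sup>2)))
    \<le> (norm (\<iota> (w 0)))\<^sup>2 + \<Delta> * (\<Sum>j=1..n. 2 / \<kappa> * (r * (1 + e) * (norm (U0 j) + 1))\<^sup>2)"
    unfolding \<gamma>_def
  proof (rule energy_estimate_discrete[OF linear_embed _ _ \<kappa>_pos \<Delta> dt[folded \<Delta>_def] n])
    fix j assume j: "j \<in> {1..m}"
    let ?h = "f (tgrid T m j)"
    have "\<iota> (w j - w (j - 1)) = \<iota> (U1 j - U1 (j - 1)) - \<iota> (U0 j - U0 (j - 1))"
      by (simp add: w_def embed_diff)
    then show "inner (\<iota> (w j - w (j - 1))) (\<iota> (w j))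
        = \<Delta> * (res \<mu>1 ?h (U1 j) (w j) - res \<mu>0 ?h (U0 j) (w j))"
      using reduced_solution_step[OF U0 linear_embed T_pos m j, of "w j"]
        reduced_solution_step[OF U1 linear_embed T_pos m j, of "w j"] wV[of j] j
      by (simp add: inner_diff_left \<Delta>_def right_diff_distrib)
    show "res \<mu>1 ?h (U1 j) (w j) - res \<mu>0 ?h (U0 j) (w j)
        \<le> - \<kappa> * (norm (w j))\<^sup>2 + r * (1 + e) * (norm (U0 j) + 1) * norm (w j)
          + L * norm (w j) * norm (\<iota> (w j))"
      unfolding w_def r_def by (rule diff_bound[OF \<mu>])
  qed
  moreover have "\<iota> (w 0) = 0"
  proof -
    have "inner (\<iota> (w 0)) (\<iota> (w 0)) = 0"
    proof -
      have "inner (\<iota> (U0 0)) (\<iota> (w 0)) = inner (\<iota> \<phi>) (\<iota> (w 0))"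
        and "inner (\<iota> (U1 0)) (\<iota> (w 0)) = inner (\<iota> \<phi>) (\<iota> (w 0))"
        using U0 U1 wV[of 0] by (simp_all add: reduced_solution_def)
      moreover have "\<iota> (w 0) = \<iota> (U1 0) - \<iota> (U0 0)" by (simp add: w_def embed_diff)
      ultimately show ?thesis by (metis inner_diff_left right_minus_eq)
    qed
    then show ?thesis by simp
  qed
  moreover have "0 \<le> \<kappa> / 2 * (\<Delta> * (\<Sum>j=1..n. (norm (w j))\<^sup>2))"
    using \<kappa>_pos \<Delta>(1) by (intro mult_nonneg_nonneg sum_nonneg) auto
  then have "\<gamma> * (norm (\<iota> (w n)))\<^sup>2
      \<le> \<gamma> * ((norm (\<iota> (w n)))\<^sup>2 + \<kappa> / 2 * (\<Delta> * (\<Sum>j=1..n. (norm (w j))\<^sup>2)))"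
    using \<gamma>_pos by simp
  ultimately have "\<gamma> * (norm (\<iota> (w n)))\<^sup>2
      \<le> \<Delta> * (\<Sum>j=1..n. 2 / \<kappa> * (r * (1 + e) * (norm (U0 j) + 1))\<^sup>2)" by simp
  also have "\<dots> \<le> \<Delta> * (\<Sum>j=1..n. 2 / \<kappa> * (1 + e)\<^sup>2 * r\<^sup>2 * (2 * (norm (U0 j))\<^sup>2 + 2))"
    by (intro mult_left_mono sum_mono data_bound_square \<Delta>)
  also have "\<dots> = 2 / \<kappa> * (1 + e)\<^sup>2 * r\<^sup>2 * (2 * (\<Delta> * (\<Sum>j=1..n. (norm (U0 j))\<^sup>2)) + 2 * (real n * \<Delta>))"
  proof -
    have "(\<Sum>j=1..n. K * (2 * (norm (U0 j))\<^sup>2 + 2)) = K * (2 * (\<Sum>j=1..n. (norm (U0 j))\<^sup>2) + 2 * real n)" for K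
      by (simp add: sum.distrib flip: sum_distrib_left)
    then show ?thesis by (simp only:) (simp only: distrib_left ac_simps)
  qed
  also have "\<dots> \<le> 2 / \<kappa> * (1 + e)\<^sup>2 * r\<^sup>2 * (2 * state_bound + 2 * T)"
  proof -
    have "real n * \<Delta> \<le> T"
      using n \<Delta> by (metis mult_right_mono of_nat_le_iff)
    then show ?thesis
      using state_bound_discrete[OF \<mu>(1) m dt U0 n] \<kappa>_pos
      by (intro mult_left_mono add_mono) (auto simp: \<Delta>_def)
  qed
  finally show "\<gamma> * (norm (\<iota> (U1 n - U0 n)))\<^sup>2
      \<le> 2 / \<kappa> * (1 + e)\<^sup>2 * (\<rho> \<bar>\<mu>1 - \<mu>0\<bar>)\<^sup>2 * (2 * state_bound + 2 * T)"
    by (simp only: w_def r_def)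
qed

lemma mean_error_stability:
  assumes \<mu>: "\<mu>0 \<in> P" "\<mu>1 \<in> P" and m: "m \<ge> 1" and dt: "L\<^sup>2 / \<kappa> * (T / real m) \<le> 1/2"
    and Vl: "subspace Vl"
    and U0: "reduced_solution \<iota> T m (\<lambda>x y. a x y \<mu>0) (\<lambda>x. F x \<mu>0) f \<phi> Vl U0"
    and U1: "reduced_solution \<iota> T m (\<lambda>x y. a x y \<mu>1) (\<lambda>x. F x \<mu>1) f \<phi> Vl U1"
  shows "mean_error \<iota> T m (u \<mu>1) U1
    \<le> mean_error \<iota> T m (u \<mu>0) U0 + 2 * stability_constant * \<rho> \<bar>\<mu>1 - \<mu>0\<bar>"
proof (rule mean_error_le_add[OF m])
  show "0 \<le> 2 * stability_constant * \<rho> \<bar>\<mu>1 - \<mu>0\<bar>"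
    using order_trans[OF norm_ge_zero parameter_stability_continuous[OF \<mu>, of 0]] T_pos by simp
  fix k assume k: "k \<in> {1..m}"
  let ?t = "tgrid T m k"
  have "norm (\<iota> (u \<mu>1 ?t - u \<mu>0 ?t)) \<le> stability_constant * \<rho> \<bar>\<mu>1 - \<mu>0\<bar>"
    using k m T_pos by (intro parameter_stability_continuous[OF \<mu>] tgrid_mem) auto
  moreover have "norm (\<iota> (U1 k - U0 k)) \<le> stability_constant * \<rho> \<bar>\<mu>1 - \<mu>0\<bar>"
    using k by (intro parameter_stability_discrete[OF \<mu> m dt Vl U0 U1]) auto
  moreover have "2 * stability_constant * \<rho> \<bar>\<mu>1 - \<mu>0\<bar>
      = stability_constant * \<rho> \<bar>\<mu>1 - \<mu>0\<bar> + stability_constant * \<rho> \<bar>\<mu>1 - \<mu>0\<bar>"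
    by simp
  moreover have "norm (\<iota> (u \<mu>1 ?t) - \<iota> (U1 k))
      \<le> norm (\<iota> (u \<mu>0 ?t) - \<iota> (U0 k)) + norm (\<iota> (u \<mu>1 ?t - u \<mu>0 ?t)) + norm (\<iota> (U1 k - U0 k))"
  proof -
    have "\<iota> (u \<mu>1 ?t) - \<iota> (U1 k)
      = (\<iota> (u \<mu>0 ?t) - \<iota> (U0 k)) + (\<iota> (u \<mu>1 ?t - u \<mu>0 ?t) - \<iota> (U1 k - U0 k))"
      by (simp add: embed_diff)
    then have "norm (\<iota> (u \<mu>1 ?t) - \<iota> (U1 k))
        \<le> norm (\<iota> (u \<mu>0 ?t) - \<iota> (U0 k)) + norm (\<iota> (u \<mu>1 ?t - u \<mu>0 ?t) - \<iota> (U1 k - U0 k))"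
      by (metis norm_triangle_ineq)
    then show ?thesis
      using norm_triangle_ineq4[of "\<iota> (u \<mu>1 ?t - u \<mu>0 ?t)" "\<iota> (U1 k - U0 k)"]
      by linarith
  qed
  ultimately show "norm (\<iota> (u \<mu>1 ?t) - \<iota> (U1 k))
      \<le> norm (\<iota> (u \<mu>0 ?t) - \<iota> (U0 k)) + 2 * stability_constant * \<rho> \<bar>\<mu>1 - \<mu>0\<bar>"
    by linarith
qed

end

section \<open>Proof of the estimate\<close>

theorem theorem3p3:
  fixes \<iota> :: "'v::{real_inner, banach, second_countable_topology} \<Rightarrow>
              'h::{real_inner, banach, second_countable_topology}"
    and \<alpha> T :: real
    and P :: "real set"
    and f :: "real \<Rightarrow> 'h"
    and \<phi> :: 'v
    and a :: "'v \<Rightarrow> 'v \<Rightarrow> real \<Rightarrow> real"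
    and F :: "'v \<Rightarrow> real \<Rightarrow> 'h"
    and \<beta> \<kappa> L_F \<omega>_a \<omega>_F :: "real \<Rightarrow> real"
    and u :: "real \<Rightarrow> real \<Rightarrow> 'v"
  assumes embedding: "gelfand_embedding \<iota>"
    and alpha: "\<alpha> > 0" "\<And>x. (norm (\<iota> x))\<^sup>2 \<le> \<alpha> * (norm x)\<^sup>2"
    and T_pos: "T > 0"
    and P: "compact P" "P \<subseteq> {0<..}"
    and f_cont: "continuous_on {0..T} f"
    and a_bilinear: "\<And>\<mu>. \<mu> > 0 \<Longrightarrow> bilinear (\<lambda>x y. a x y \<mu>)"
    and beta: "continuous_on P \<beta>" "\<And>\<mu>. \<mu> \<in> P \<Longrightarrow> \<beta> \<mu> > 0"
    and kappa: "continuous_on P \<kappa>" "\<And>\<mu>. \<mu> \<in> P \<Longrightarrow> \<kappa> \<mu> > 0"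
    and L_F: "continuous_on P L_F" "\<And>\<mu>. \<mu> \<in> P \<Longrightarrow> L_F \<mu> \<ge> 0"
    and moduli: "modulus_of_continuity \<omega>_a" "modulus_of_continuity \<omega>_F"
    and A1: "\<And>\<mu> x y. \<mu> \<in> P \<Longrightarrow> \<bar>a x y \<mu>\<bar> \<le> \<beta> \<mu> * norm x * norm y"
    and A2: "\<And>\<mu> x. \<mu> \<in> P \<Longrightarrow> a x x \<mu> \<ge> \<kappa> \<mu> * (norm x)\<^sup>2"
    and A3: "\<And>\<mu> \<nu> x y. \<mu> \<in> P \<Longrightarrow> \<nu> \<in> P \<Longrightarrow>
               \<bar>a x y \<mu> - a x y \<nu>\<bar> \<le> \<omega>_a \<bar>\<mu> - \<nu>\<bar> * norm x * norm y"
    and F1: "\<And>\<mu> x y. \<mu> \<in> P \<Longrightarrow> norm (F x \<mu> - F y \<mu>) \<le> L_F \<mu> * norm (x - y)"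
    and F2: "\<And>\<mu> \<nu> x. \<mu> \<in> P \<Longrightarrow> \<nu> \<in> P \<Longrightarrow>
               norm (F x \<mu> - F x \<nu>) \<le> \<omega>_F \<bar>\<mu> - \<nu>\<bar> * (norm x + 1)"
    and u_solves: "\<And>\<mu>. \<mu> \<in> P \<Longrightarrow>
               solves \<iota> T (\<lambda>x y. a x y \<mu>) (\<lambda>x. F x \<mu>) f \<phi> (\<lambda>t. \<iota> (u \<mu> t))"
    and u_unique: "\<And>\<mu> w t. \<mu> \<in> P \<Longrightarrow>
               solves \<iota> T (\<lambda>x y. a x y \<mu>) (\<lambda>x. F x \<mu>) f \<phi> w \<Longrightarrow>
               t \<in> {0..T} \<Longrightarrow> w t = \<iota> (u \<mu> t)"
    and u_regular: "\<And>\<mu>. \<mu> \<in> P \<Longrightarrow> continuous_on {0..T} (u \<mu>)"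
               "\<And>\<mu>. \<mu> \<in> P \<Longrightarrow> W22 T (\<lambda>t. \<iota> (u \<mu> t))"
  shows "\<exists>C>0. \<forall>\<mu>0\<in>P. \<forall>\<mu>1\<in>P. \<forall>m\<ge>1.
           time_step_condition P \<kappa> L_F \<mu>0 (T / real m) \<longrightarrow>
           (\<forall>lam v. pod_eigenpairs m (snapshot T m (u \<mu>0)) lam v \<longrightarrow>
             (\<forall>l\<in>{1..snapshot_dim m (snapshot T m (u \<mu>0))}. \<forall>U0 U1.
               reduced_solution \<iota> T m (\<lambda>x y. a x y \<mu>0) (\<lambda>x. F x \<mu>0) f \<phi>
                 (pod_space m (snapshot T m (u \<mu>0)) lam v l) U0 \<longrightarrow>
               reduced_solution \<iota> T m (\<lambda>x y. a x y \<mu>1) (\<lambda>x. F x \<mu>1) f \<phi>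
                 (pod_space m (snapshot T m (u \<mu>0)) lam v l) U1 \<longrightarrow>
               mean_error \<iota> T m (u \<mu>1) U1
                 \<le> mean_error \<iota> T m (u \<mu>0) U0
                   + C * (\<omega>_a \<bar>\<mu>1 - \<mu>0\<bar> + \<omega>_F \<bar>\<mu>1 - \<mu>0\<bar>)))"
proof (cases "P = {}")
  case True
  then show ?thesis by (auto intro: exI[of _ 1])
next
  case False
  define \<kappa>0 where "\<kappa>0 = (INF \<mu>\<in>P. \<kappa> \<mu>)"
  define L where "L = (SUP \<mu>\<in>P. L_F \<mu>)"
  have "compact (\<kappa> ` P)" "compact (L_F ` P)"
    using P(1) kappa(1) L_F(1) by (auto intro: compact_continuous_image)
  then have bdd: "bdd_below (\<kappa> ` P)" "bdd_above (L_F ` P)"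
    by (auto intro: bounded_imp_bdd_below bounded_imp_bdd_above compact_imp_bounded)
  have \<kappa>0_le: "\<kappa>0 \<le> \<kappa> \<mu>" and L_ge: "L_F \<mu> \<le> L" if "\<mu> \<in> P" for \<mu>
    using bdd that by (auto simp: \<kappa>0_def L_def intro: cINF_lower cSUP_upper)
  obtain \<mu>min where \<mu>min: "\<mu>min \<in> P" "\<And>\<mu>. \<mu> \<in> P \<Longrightarrow> \<kappa> \<mu>min \<le> \<kappa> \<mu>"
    using continuous_attains_inf[OF P(1) False kappa(1)] by blast
  then have "\<kappa> \<mu>min \<le> \<kappa>0" unfolding \<kappa>0_def by (intro cINF_greatest False)
  then have \<kappa>0_pos: "\<kappa>0 > 0" using kappa(2)[OF \<mu>min(1)] by linarith
  have embed_le: "norm (\<iota> x) \<le> sqrt \<alpha> * norm x" for x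
    using real_sqrt_le_mono[OF alpha(2)[of x]] by (simp add: real_sqrt_mult)
  obtain Mf where Mf: "\<And>t. t \<in> {0..T} \<Longrightarrow> norm (f t) \<le> Mf"
    using compact_imp_bounded[OF compact_continuous_image[OF f_cont compact_Icc]]
    by (metis bounded_iff imageI)
  obtain MF where MF: "\<And>\<mu>. \<mu> \<in> P \<Longrightarrow> norm (F 0 \<mu>) \<le> MF"
    using ex_uniform_norm_bound[OF P(1) moduli(2), of "F 0"] F2[of _ _ 0] by auto
  interpret parametric_problem \<iota> T P f \<phi> a F \<beta> \<kappa>0 L "sqrt \<alpha>" "Mf + MF" \<omega>_a \<omega>_F u
  proof (rule parametric_problem.intro)
    show "bounded_linear \<iota>" "inj \<iota>" using embedding by (auto simp: gelfand_embedding_def)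
    fix \<mu> x y assume \<mu>: "\<mu> \<in> P"
    show "bilinear (\<lambda>x y. a x y \<mu>)" using \<mu> P(2) by (intro a_bilinear) auto
    show "a x x \<mu> \<ge> \<kappa>0 * (norm x)\<^sup>2"
      by (rule order_trans[OF mult_right_mono[OF \<kappa>0_le[OF \<mu>]] A2[OF \<mu>]]) simp
    show "norm (F x \<mu> - F y \<mu>) \<le> L * norm (x - y)"
      by (rule order_trans[OF F1[OF \<mu>] mult_right_mono[OF L_ge[OF \<mu>]]]) simp
    show "norm (f t) + norm (F 0 \<mu>) \<le> Mf + MF" if "t \<in> {0..T}" for t
      by (intro add_mono Mf MF that \<mu>)
  next
    show "sqrt \<alpha> \<ge> 0" using alpha(1) by simp
  qed (rule embed_le T_pos f_cont A1 \<kappa>0_pos moduli A3 F2 u_solves u_regular | assumption)+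
  \<comment> \<open>The added 1 makes the constant positive also when the stability constant is zero.\<close>
  define C where "C = 2 * \<bar>stability_constant\<bar> + 1"
  have "mean_error \<iota> T m (u \<mu>1) U1 \<le> mean_error \<iota> T m (u \<mu>0) U0 + C * \<rho> \<bar>\<mu>1 - \<mu>0\<bar>"
    if \<mu>: "\<mu>0 \<in> P" "\<mu>1 \<in> P" and m: "m \<ge> 1"
      and S: "time_step_condition P \<kappa> L_F \<mu>0 (T / real m)"
      and U0: "reduced_solution \<iota> T m (\<lambda>x y. a x y \<mu>0) (\<lambda>x. F x \<mu>0) f \<phi> (pod_space m y lam v l) U0"
      and U1: "reduced_solution \<iota> T m (\<lambda>x y. a x y \<mu>1) (\<lambda>x. F x \<mu>1) f \<phi> (pod_space m y lam v l) U1"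
    for \<mu>0 \<mu>1 m y lam v l U0 U1
  proof -
    have "L\<^sup>2 / \<kappa>0 * (T / real m) \<le> 1/2"
      using S by (simp add: time_step_condition_def L_def \<kappa>0_def)
    moreover have "subspace (pod_space m y lam v l)"
      by (simp add: pod_space_def subspace_span)
    ultimately have "mean_error \<iota> T m (u \<mu>1) U1
        \<le> mean_error \<iota> T m (u \<mu>0) U0 + 2 * stability_constant * \<rho> \<bar>\<mu>1 - \<mu>0\<bar>"
      by (intro mean_error_stability[OF \<mu> m _ _ U0 U1])
    also have "2 * stability_constant * \<rho> \<bar>\<mu>1 - \<mu>0\<bar> \<le> C * \<rho> \<bar>\<mu>1 - \<mu>0\<bar>"
      using moduli by (intro mult_right_mono) (auto simp: C_def modulus_nonneg)
    finally show ?thesis by simp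
  qed
  moreover have "C > 0" by (simp add: C_def)
  ultimately show ?thesis by (intro exI[of _ C] conjI ballI allI impI)
qed

end
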